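(* Let $G$ be a connected graph with two distinct vertices $v$ and $u$, let $n\geq 1$ be an integer, and let $\mathcal{F}^{++}_n$ be the graph obtained from the fan-like graph $\mathcal{F}_n$ (built from $n$ copies of $G$) by adding the two end edges described in the context; let $G^{++}=\mathcal{F}^{++}_1$. Write $T(\cdot)=T(\cdot;x,y)$ for the Tutte polynomial and put \begin{align*} A&=\frac{x}{xy-x-y}\big((y-1)T(G)-T(G/\{v,u\})\big),\\ B&=\frac{1}{xy-x-y}\big((x-1)T(G/\{v,u\})-T(G)\big),\\ C&=\frac{1}{xy-x-y}\big((xy-y-1)T(G/\{v,u\})-T(G)\big),\\ \lambda_{1,2}&=\frac{A+C\pm\sqrt{(A-C)^2+4AB}}{2}. \end{align*} Then $$T(\mathcal{F}^{++}_n)=T(G^{++})\frac{\lambda^n_1-\lambda^n_2}{\lambda_1-\lambda_2}-yA\,T(G/\{v,u\})\frac{\lambda^{n-1}_1-\lambda^{n-1}_2}{\lambda_1-\lambda_2},$$ and equivalently \begin{align*} T(\mathcal{F}^{++}_n)=&T(G^{++})\sum_{j=0}^{\lfloor \frac{n-1}{2}\rfloor}\binom{n-j-1}{j}(A+C)^{n-2j-1}(AB-AC)^{j}\\ &-yA\,T(G/\{v,u\})\sum_{j=0}^{\lfloor \frac{n-2}{2}\rfloor}\binom{n-j-2}{j}(A+C)^{n-2j-2}A^{j}(B-C)^{j}. \end{align*}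
   Context: Graphs are finite; loops and multiple edges are allowed. The Tutte polynomial of a graph $G=(V,E)$ is $T(G;x,y)=\sum_{S\subseteq E}(x-1)^{r(E)-r(S)}(y-1)^{|S|-r(S)}$, where $r(S)=|V|-\omega(V,S)$ and $\omega(V,S)$ is the number of connected components of $(V,S)$. For $S\subseteq V$, $G/S$ denotes the graph obtained from $G$ by identifying all vertices of $S$ into one new vertex, with all edges preserved (edges inside $S$ become loops). Fan-like graph $\mathcal{F}_n$: let $H_1,\dots,H_n$ be disjoint copies of $G$. Identify the $n$ copies of $v$ into one vertex (again called $v$), and for each $i=1,\dots,n-1$ add an edge $e_i$ joining the copy of $u$ in $H_i$ to the copy of $u$ in $H_{i+1}$. The graph $\mathcal{F}^{+}_n$ is obtained from $\mathcal{F}_n$ by adding a new edge joining $v$ and the vertex $u$ of $H_1$; $\mathcal{F}^{++}_n$ is obtained from $\mathcal{F}^{+}_n$ by adding another new edge joining $v$ and the vertex $u$ of $H_n$. In particular $G^{++}=\mathcal{F}^{++}_1$ is $G$ with two additional parallel edges joining $v$ and $u$. Identities are between elements of an algebraic closure of $\mathbb{Q}(x,y)$; empty sums are $0$. *)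

theory Defs
  imports
    "HOL-Library.Uprod"
    "HOL-Computational_Algebra.Polynomial_Factorial"
    "HOL-Algebra.Algebraic_Closure_Type"
begin

text \<open>
  Loops are edges with \<open>ends e = Upair w w\<close>; parallel edges are distinct edges with equal ends.
\<close>

record ('v, 'e) multigraph =
  vertices :: "'v set"
  edges :: "'e set"
  ends :: "'e \<Rightarrow> 'v uprod"

definition finite_multigraph :: "('v, 'e) multigraph \<Rightarrow> bool" where
  "finite_multigraph G \<longleftrightarrow>
     finite (vertices G) \<and> finite (edges G) \<and> (\<forall>e\<in>edges G. set_uprod (ends G e) \<subseteq> vertices G)"

definition adjacency :: "('v, 'e) multigraph \<Rightarrow> 'e set \<Rightarrow> ('v \<times> 'v) set" where
  "adjacency G S = {(a, b). \<exists>e\<in>S. ends G e = Upair a b}"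

definition components :: "('v, 'e) multigraph \<Rightarrow> 'e set \<Rightarrow> 'v set set" where
  "components G S = vertices G // ((adjacency G S)\<^sup>* \<inter> vertices G \<times> vertices G)"

definition connected_multigraph :: "('v, 'e) multigraph \<Rightarrow> bool" where
  "connected_multigraph G \<longleftrightarrow>
     vertices G \<noteq> {} \<and> (\<forall>a\<in>vertices G. \<forall>b\<in>vertices G. (a, b) \<in> (adjacency G (edges G))\<^sup>*)"

text \<open>
  The natural-number subtractions in the next two definitions never truncate when \<open>G\<close> is a finite
  multigraph and \<open>S \<subseteq> edges G\<close>: there are at most \<open>|V|\<close> components, and
  \<open>r(S) \<le> r(E)\<close>, \<open>r(S) \<le> |S|\<close>.
\<close>

definition edge_rank :: "('v, 'e) multigraph \<Rightarrow> 'e set \<Rightarrow> nat" where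
  "edge_rank G S = card (vertices G) - card (components G S)"

definition tutte :: "('v, 'e) multigraph \<Rightarrow> 'a::comm_ring_1 \<Rightarrow> 'a \<Rightarrow> 'a" where
  "tutte G x y =
     (\<Sum>S\<in>Pow (edges G).
        (x - 1) ^ (edge_rank G (edges G) - edge_rank G S) * (y - 1) ^ (card S - edge_rank G S))"

text \<open>In \<open>identify G S\<close> the new vertex is \<^const>\<open>None\<close>; a vertex \<open>w\<close> outside \<open>S\<close> becomes \<open>Some w\<close>.\<close>

definition identify :: "('v, 'e) multigraph \<Rightarrow> 'v set \<Rightarrow> ('v option, 'e) multigraph" where
  "identify G S =
     (let f = (\<lambda>w. if w \<in> S then None else Some w)
      in \<lparr>vertices = f ` vertices G, edges = edges G, ends = (\<lambda>e. map_uprod f (ends G e))\<rparr>)"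

definition add_edges ::
  "('v, 'e) multigraph \<Rightarrow> 'i set \<Rightarrow> ('i \<Rightarrow> 'v uprod) \<Rightarrow> ('v, 'e + 'i) multigraph" where
  "add_edges G I f =
     \<lparr>vertices = vertices G, edges = Inl ` edges G \<union> Inr ` I, ends = case_sum (ends G) f\<rparr>"

definition add_edge :: "('v, 'e) multigraph \<Rightarrow> 'v \<Rightarrow> 'v \<Rightarrow> ('v, 'e + unit) multigraph" where
  "add_edge G a b = add_edges G {()} (\<lambda>_. Upair a b)"

definition copies :: "nat \<Rightarrow> ('v, 'e) multigraph \<Rightarrow> (nat \<times> 'v, nat \<times> 'e) multigraph" where
  "copies n G =
     \<lparr>vertices = {1..n} \<times> vertices G, edges = {1..n} \<times> edges G,
      ends = (\<lambda>(i, e). map_uprod (Pair i) (ends G e))\<rparr>"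

text \<open>
  In the fan-like graph the common vertex \<open>v\<close> is \<^const>\<open>None\<close>, and the copy of \<open>u\<close> in \<open>H\<^sub>i\<close> is
  \<open>Some (i, u)\<close> (for \<open>u \<noteq> v\<close>).
\<close>

definition fan ::
  "('v, 'e) multigraph \<Rightarrow> 'v \<Rightarrow> 'v \<Rightarrow> nat \<Rightarrow> ((nat \<times> 'v) option, nat \<times> 'e + nat) multigraph" where
  "fan G v u n =
     add_edges (identify (copies n G) ({1..n} \<times> {v})) {1..<n}
       (\<lambda>i. Upair (Some (i, u)) (Some (i + 1, u)))"

definition fan_plus ::
  "('v, 'e) multigraph \<Rightarrow> 'v \<Rightarrow> 'v \<Rightarrow> nat \<Rightarrow>
     ((nat \<times> 'v) option, (nat \<times> 'e + nat) + unit) multigraph" where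
  "fan_plus G v u n = add_edge (fan G v u n) None (Some (1, u))"

definition fan_plus_plus ::
  "('v, 'e) multigraph \<Rightarrow> 'v \<Rightarrow> 'v \<Rightarrow> nat \<Rightarrow>
     ((nat \<times> 'v) option, ((nat \<times> 'e + nat) + unit) + unit) multigraph" where
  "fan_plus_plus G v u n = add_edge (fan_plus G v u n) None (Some (n, u))"

definition graph_plus_plus ::
  "('v, 'e) multigraph \<Rightarrow> 'v \<Rightarrow> 'v \<Rightarrow>
     ((nat \<times> 'v) option, ((nat \<times> 'e + nat) + unit) + unit) multigraph" where
  "graph_plus_plus G v u = fan_plus_plus G v u 1"

text \<open>
  The algebraic closure of \<open>\<rat>(x, y)\<close>, with \<open>\<rat>(x, y)\<close> the fraction field of \<open>\<rat>[x][y]\<close>.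
\<close>

type_synonym Qxy_closure = "rat poly poly fract alg_closure"

definition \<x> :: Qxy_closure where
  "\<x> = to_ac (to_fract [:[:0, 1:]:])"

definition \<y> :: Qxy_closure where
  "\<y> = to_ac (to_fract [:0, 1:])"

definition T :: "('v, 'e) multigraph \<Rightarrow> Qxy_closure" where
  "T G = tutte G \<x> \<y>"

end

theory Submission
  imports Defs
begin

text \<open>
  Fix \<open>v\<close> and \<open>u\<close> and split the sum over edge sets that defines \<open>T(G)\<close> into the edge sets that join
  \<open>v\<close> to \<open>u\<close> and those that do not. Up to normalisation this gives two numbers \<open>P\<close> and \<open>R\<close> with
  \<open>T(G) = P + (x - 1) R\<close>. Identifying \<open>v\<close> and \<open>u\<close> lowers the number of components exactly for the
  sets of the second kind, which gives \<open>T(G/{v,u}) = (y - 1) P + R\<close>. Solving for \<open>P\<close> and \<open>R\<close>, the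
  quantities of the theorem become \<open>A = x R\<close>, \<open>B = P\<close>, \<open>C = y P + R\<close>, and \<open>C - B = T(G/{v,u})\<close>.

  Apply the same splitting to the fan with \<open>n\<close> copies and the edge from \<open>v\<close> to the first copy,
  with \<open>v\<close> and the last copy of \<open>u\<close> as terminals. One more copy is a pendant edge followed by a
  parallel composition with \<open>G\<close>; both operations act linearly on the pair of sums. The resulting
  transfer matrix (\<open>fan_transfer_matrix\<close>) has trace \<open>A + C\<close> and determinant \<open>A (C - B)\<close>. Hence the
  Tutte polynomials \<open>t(n)\<close> of the fans with both end edges satisfy
  \<open>t(n+2) = (A + C) t(n+1) - A (C - B) t(n)\<close>, which extends to \<open>n = 0\<close> with \<open>t(0) = y\<close>. Both
  formulas of the theorem are the standard solutions of this recurrence, by Binet's formula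
  (\<open>lucas_seq_binet\<close>) and by diagonal sums of binomial coefficients (\<open>lucas_seq_binomial\<close>).

  Binet's formula requires distinct roots. The discriminant \<open>(A - C)\<^sup>2 + 4 A B\<close> is a polynomial in
  \<open>x\<close> and \<open>y\<close> up to a nonzero factor, and it is positive at \<open>x = y = 2\<close>, where \<open>P\<close> and \<open>R\<close> count
  edge sets (\<open>discriminant_nonzero\<close>).

  The combinatorial core is how the number of components of an edge set behaves under
  gluing two graphs at two vertices (\<open>ncomp_glue\<close>). It follows from the effect of adding a single
  edge, since the loss caused by an edge depends only on whether its ends are already joined.
\<close>

section \<open>Counting connected components\<close>

text \<open>
  The components of a graph are studied as those of a vertex set \<open>V\<close> under an arbitrary relation
  \<open>R\<close>, because the gluing argument below needs a virtual connection between two vertices that is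
  not one of the edges.
\<close>

definition ncomp :: "'v set \<Rightarrow> ('v \<times> 'v) set \<Rightarrow> nat" where
  "ncomp V R = card ((\<lambda>a. {b \<in> V. (a, b) \<in> R\<^sup>*}) ` V)"

lemma card_components: "card (components G S) = ncomp (vertices G) (adjacency G S)"
proof -
  have "components G S =
      (\<lambda>a. {b \<in> vertices G. (a, b) \<in> (adjacency G S)\<^sup>*}) ` vertices G"
    unfolding components_def quotient_def UNION_singleton_eq_range
    by (rule image_cong) auto
  then show ?thesis by (simp add: ncomp_def)
qed

lemma sym_adjacency: "sym (adjacency G S)"
proof (rule symI)
  fix a b assume "(a, b) \<in> adjacency G S"
  moreover have "Upair a b = Upair b a" by simp
  ultimately show "(b, a) \<in> adjacency G S" unfolding adjacency_def by simp
qed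

lemma adjacency_empty [simp]: "adjacency G {} = {}"
  by (simp add: adjacency_def)

lemma adjacency_Un: "adjacency G (S \<union> S') = adjacency G S \<union> adjacency G S'"
  by (auto simp: adjacency_def)

lemma adjacency_insert:
  "ends G e = Upair a b \<Longrightarrow> adjacency G (insert e S) = adjacency G S \<union> {(a, b), (b, a)}"
  by (auto simp: adjacency_def)

lemma adjacency_iff: "(a, b) \<in> adjacency G S \<longleftrightarrow> (\<exists>e\<in>S. ends G e = Upair a b)"
  by (simp add: adjacency_def)

lemma adjacencyI:
  assumes "e \<in> S" "ends G e = Upair a b"
  shows "(a, b) \<in> adjacency G S" "(b, a) \<in> adjacency G S"
  using adjacency_insert[OF assms(2), of S] assms(1)
  by (metis UnI2 insertCI insert_absorb)+

lemma finite_edges: "finite_multigraph G \<Longrightarrow> finite (edges G)"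
  by (simp add: finite_multigraph_def)

lemma finite_vertices: "finite_multigraph G \<Longrightarrow> finite (vertices G)"
  by (simp add: finite_multigraph_def)

lemma adjacency_cong:
  "(\<And>e. e \<in> S \<Longrightarrow> ends G e = ends H e) \<Longrightarrow> adjacency G S = adjacency H S"
  by (auto simp: adjacency_def)

lemma adjacency_subset:
  assumes "finite_multigraph G" "S \<subseteq> edges G"
  shows "adjacency G S \<subseteq> vertices G \<times> vertices G"
proof (clarify)
  fix a b assume "(a, b) \<in> adjacency G S"
  then obtain e where "e \<in> S" "ends G e = Upair a b" by (auto simp: adjacency_def)
  moreover from this assms have "set_uprod (ends G e) \<subseteq> vertices G"
    by (meson finite_multigraph_def subsetD)
  ultimately show "a \<in> vertices G \<and> b \<in> vertices G" by simp
qed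

lemma rtrancl_adjacency_sym: "(a, b) \<in> (adjacency G S)\<^sup>* \<longleftrightarrow> (b, a) \<in> (adjacency G S)\<^sup>*"
  by (meson sym_adjacency sym_rtrancl symE)

lemma rtrancl_add_edge:
  "(x, y) \<in> (R \<union> {(a, b), (b, a)})\<^sup>* \<longleftrightarrow>
    (x, y) \<in> R\<^sup>* \<or> (x, a) \<in> R\<^sup>* \<and> (b, y) \<in> R\<^sup>* \<or> (x, b) \<in> R\<^sup>* \<and> (a, y) \<in> R\<^sup>*"
proof -
  have "(x, y) \<in> R\<^sup>*" if "(x, p) \<in> R\<^sup>*" "(p, y) \<in> R\<^sup>*" for p
    using that by (rule rtrancl_trans)
  moreover have "R \<union> {(a, b), (b, a)} = insert (a, b) (insert (b, a) R)" by auto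
  ultimately show ?thesis by (simp add: rtrancl_insert) blast
qed

lemma rtrancl_map_into:
  assumes "(a, b) \<in> R\<^sup>*" and step: "\<And>x y. (x, y) \<in> R \<Longrightarrow> (f x, f y) \<in> Q\<^sup>*"
  shows "(f a, f b) \<in> Q\<^sup>*"
  using assms(1) by induction (auto intro: rtrancl_trans step)

text \<open>
  A map that is onto and both preserves and reflects reachability carries components
  bijectively to components. It need not be injective on vertices: this is what handles the
  identification of two vertices.
\<close>

lemma ncomp_map:
  assumes surj: "h ` V = V'"
    and reach: "\<And>a b. a \<in> V \<Longrightarrow> b \<in> V \<Longrightarrow> (h a, h b) \<in> R'\<^sup>* \<longleftrightarrow> (a, b) \<in> R\<^sup>*"
  shows "ncomp V' R' = ncomp V R"
proof -
  let ?cl = "\<lambda>a. {b \<in> V. (a, b) \<in> R\<^sup>*}" and ?cl' = "\<lambda>a. {b \<in> V'. (a, b) \<in> R'\<^sup>*}"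
  have img: "?cl' (h a) = h ` ?cl a" if "a \<in> V" for a
    using that surj reach by (auto simp: image_iff)
  have pre: "?cl a = {b \<in> V. h b \<in> ?cl' (h a)}" if "a \<in> V" for a
    using that surj reach by auto
  have "?cl' ` V' = (`) h ` ?cl ` V"
    unfolding surj[symmetric] image_image using img surj by (intro image_cong) auto
  moreover have "inj_on ((`) h) (?cl ` V)"
  proof (rule inj_onI, clarify)
    fix a b assume "a \<in> V" "b \<in> V" "h ` ?cl a = h ` ?cl b"
    then have "?cl' (h a) = ?cl' (h b)" 

      unfolding img[OF \<open>a \<in> V\<close>] img[OF \<open>b \<in> V\<close>] by (simp only:)
    then show "?cl a = ?cl b" using pre[OF \<open>a \<in> V\<close>] pre[OF \<open>b \<in> V\<close>] by simp
  qed
  ultimately show ?thesis by (simp add: ncomp_def card_image)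
qed

text \<open>
  A new edge merges the components of its two ends, and changes nothing if these already
  coincide. The counts for gluing and for identification of vertices are
  reduced to this case.
\<close>

lemma ncomp_add_edge:
  assumes "finite V" "sym R" "a \<in> V" "b \<in> V"
  shows "ncomp V R = ncomp V (R \<union> {(a, b), (b, a)}) + of_bool ((a, b) \<notin> R\<^sup>*)"
proof -
  let ?R = "R \<union> {(a, b), (b, a)}"
  define cl where "cl x = {y \<in> V. (x, y) \<in> R\<^sup>*}" for x
  have s: "(p, q) \<in> R\<^sup>* \<longleftrightarrow> (q, p) \<in> R\<^sup>*" for p q
    using assms by (meson sym_rtrancl symE)
  have cl_eq: "cl x = cl y \<longleftrightarrow> (x, y) \<in> R\<^sup>*" if "x \<in> V" "y \<in> V" for x y
    proof
    assume "cl x = cl y"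
    then have "y \<in> cl x" using that by (simp add: cl_def)
    then show "(x, y) \<in> R\<^sup>*" by (simp add: cl_def)
  next
    assume "(x, y) \<in> R\<^sup>*"
    then have "(x, z) \<in> R\<^sup>* \<longleftrightarrow> (y, z) \<in> R\<^sup>*" for z
      using s[of x y] rtrancl_trans[of x y R z] rtrancl_trans[of y x R z] by blast
    then show "cl x = cl y" by (simp add: cl_def)
  qed
  show ?thesis
  proof (cases "(a, b) \<in> R\<^sup>*")
    case True
    with s have "{(a, b), (b, a)} \<subseteq> R\<^sup>*" by auto
    then have "?R\<^sup>* = R\<^sup>*" by (intro rtrancl_subset) auto
    with True show ?thesis by (simp add: ncomp_def)
  next
    case False
    \<comment> \<open>On the set of components, the new edge acts by replacing both classes by their union.\<close>
    define merge where "merge K = (if K \<in> {cl a, cl b} then cl a \<union> cl b else K)" for K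
    have "{y \<in> V. (x, y) \<in> ?R\<^sup>*} = merge (cl x)" if x: "x \<in> V" for x
    proof -
      have xa: "cl x = cl a \<longleftrightarrow> (x, a) \<in> R\<^sup>*" and xb: "cl x = cl b \<longleftrightarrow> (x, b) \<in> R\<^sup>*"
        using cl_eq x assms by auto
      consider "cl x = cl a" "cl x \<noteq> cl b" | "cl x = cl b" "cl x \<noteq> cl a"
        | "cl x \<noteq> cl a" "cl x \<noteq> cl b"
        using cl_eq assms False by blast
      then show ?thesis
      proof cases
        case 1
        then have "{y \<in> V. (x, y) \<in> ?R\<^sup>*} = cl x \<union> cl b"
          unfolding rtrancl_add_edge using xa xb by (auto simp: cl_def)
        with 1 show ?thesis by (simp add: merge_def)
      next
        case 2
        then have "{y \<in> V. (x, y) \<in> ?R\<^sup>*} = cl x \<union> cl a"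
          unfolding rtrancl_add_edge using xa xb by (auto simp: cl_def)
        with 2 show ?thesis by (simp add: merge_def Un_commute)
      next
        case 3
        then have "{y \<in> V. (x, y) \<in> ?R\<^sup>*} = cl x"
          unfolding rtrancl_add_edge using xa xb by (auto simp: cl_def)
        with 3 show ?thesis by (simp add: merge_def)
      qed
    qed
    then have "(\<lambda>x. {y \<in> V. (x, y) \<in> ?R\<^sup>*}) ` V = merge ` cl ` V"
      unfolding image_image by (intro image_cong) auto
    also have "\<dots> = insert (cl a \<union> cl b) (cl ` V - {cl a, cl b})"
      using assms by (auto simp: merge_def)
    finally have new: "ncomp V ?R = card (insert (cl a \<union> cl b) (cl ` V - {cl a, cl b}))"
      by (simp add: ncomp_def)
    have "cl a \<noteq> cl b" using cl_eq assms False by blast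
    have "cl a \<union> cl b \<noteq> cl x" if "x \<in> V" for x
    proof
      assume *: "cl a \<union> cl b = cl x"
      have "a \<in> cl a" "b \<in> cl b" using assms by (auto simp: cl_def)
      then have "(x, a) \<in> R\<^sup>*" "(x, b) \<in> R\<^sup>*" using * by (auto simp: cl_def)
      then show False using False s rtrancl_trans[of a x R b] by blast
    qed
    then have "card (insert (cl a \<union> cl b) (cl ` V - {cl a, cl b})) =
        Suc (card (cl ` V - {cl a, cl b}))"
      using assms by (intro card_insert_disjoint) auto
    moreover have "card (cl ` V) = card (cl ` V - {cl a, cl b}) + 2"
    proof -
      have "card (cl ` V - {cl a, cl b}) = card (cl ` V) - card {cl a, cl b}"
        using assms by (intro card_Diff_subset) auto
      moreover have "card {cl a, cl b} \<le> card (cl ` V)"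
        using assms by (intro card_mono) auto
      ultimately show ?thesis using \<open>cl a \<noteq> cl b\<close> by simp
    qed
    moreover have "ncomp V R = card (cl ` V)" by (simp add: ncomp_def cl_def)
    ultimately show ?thesis using new False by simp
  qed
qed

lemma ncomp_empty: "ncomp V {} = card V"
proof -
  have "inj_on (\<lambda>a. {b \<in> V. (a, b) \<in> ({} :: ('a \<times> 'a) set)\<^sup>*}) V"
    by (auto simp: inj_on_def)
  then show ?thesis by (simp add: ncomp_def card_image)
qed

lemma not_reach_isolated:
  assumes "R \<subseteq> V \<times> V" "z \<notin> V" "a \<noteq> z"
  shows "(a, z) \<notin> R\<^sup>*" "(z, a) \<notin> R\<^sup>*"
proof -
  have "(x, z) \<notin> R" "(z, x) \<notin> R" for x using assms(1,2) by auto
  then show "(a, z) \<notin> R\<^sup>*" "(z, a) \<notin> R\<^sup>*"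
    using assms(3) by (metis rtranclE, metis converse_rtranclE)
qed

lemma ncomp_isolated:
  assumes "finite V" "R \<subseteq> V \<times> V" "z \<notin> V"
  shows "ncomp (insert z V) R = Suc (ncomp V R)"
proof -
  have "{b \<in> insert z V. (a, b) \<in> R\<^sup>*} = {b \<in> V. (a, b) \<in> R\<^sup>*}" if "a \<in> V" for a
  proof -
    have "(a, z) \<notin> R\<^sup>*" using not_reach_isolated[OF assms(2,3), of a] that assms(3) by blast
    then show ?thesis by auto
  qed
  moreover have "{b \<in> insert z V. (z, b) \<in> R\<^sup>*} = {z}"
    using not_reach_isolated[OF assms(2,3)] assms(3) by blast
  ultimately have "(\<lambda>a. {b \<in> insert z V. (a, b) \<in> R\<^sup>*}) ` insert z V =
      insert {z} ((\<lambda>a. {b \<in> V. (a, b) \<in> R\<^sup>*}) ` V)"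
    by (simp cong: image_cong)
  moreover have "{z} \<notin> (\<lambda>a. {b \<in> V. (a, b) \<in> R\<^sup>*}) ` V" using assms(3) by auto
  ultimately show ?thesis using assms(1) by (simp add: ncomp_def)
qed

lemma ncomp_isolated_Un:
  assumes "finite I" "finite V" "R \<subseteq> V \<times> V" "I \<inter> V = {}"
  shows "ncomp (V \<union> I) R = ncomp V R + card I"
  using assms
proof (induction I)
  case (insert z I)
  have "ncomp (insert z (V \<union> I)) R = Suc (ncomp (V \<union> I) R)"
    using insert by (intro ncomp_isolated) auto
  then show ?case using insert by simp
qed simp

lemma edge_ends:
  assumes "finite_multigraph G" "e \<in> edges G"
  obtains a b where "ends G e = Upair a b" "a \<in> vertices G" "b \<in> vertices G"
proof (cases "ends G e")
  case (Upair a b)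
  with assms that show ?thesis by (fastforce simp: finite_multigraph_def)
qed

text \<open>
  By \<open>ncomp_add_edge\<close>, how many components are lost when the edges of \<open>S\<close> are added one by one
  depends only on reachability between their ends. So two ambient graphs, here with basic relations
  \<open>B\<close> on \<open>W\<close> and \<open>D\<close> on \<open>V\<close>, in which this reachability agrees at every stage lose
  equally many components.
\<close>

lemma ncomp_increment_cong:
  assumes "finite S" "finite V" "finite W" "V \<subseteq> W" "sym B" "sym D"
    and ends: "\<And>e. e \<in> S \<Longrightarrow> \<exists>a\<in>V. \<exists>b\<in>V. ends G e = Upair a b"
    and reach: "\<And>T a b. T \<subseteq> S \<Longrightarrow> a \<in> V \<Longrightarrow> b \<in> V \<Longrightarrow>
      (a, b) \<in> (B \<union> adjacency G T)\<^sup>* \<longleftrightarrow> (a, b) \<in> (D \<union> adjacency G T)\<^sup>*"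
  shows "ncomp W (B \<union> adjacency G S) + ncomp V D = ncomp V (D \<union> adjacency G S) + ncomp W B"
  using \<open>finite S\<close> subset_refl
proof (induction S rule: finite_subset_induct')
  case (insert e T)
  obtain a b where ab: "a \<in> V" "b \<in> V" "ends G e = Upair a b"
    using ends insert by blast
  have sB: "sym (B \<union> adjacency G T)" "sym (D \<union> adjacency G T)"
    using assms by (simp_all add: sym_Un sym_adjacency)
  have eq: "B \<union> adjacency G (insert e T) = (B \<union> adjacency G T) \<union> {(a, b), (b, a)}"
    "D \<union> adjacency G (insert e T) = (D \<union> adjacency G T) \<union> {(a, b), (b, a)}"
    using adjacency_insert[OF ab(3)] by auto
  show ?case
    using ncomp_add_edge[OF \<open>finite W\<close> sB(1), of a b] ncomp_add_edge[OF \<open>finite V\<close> sB(2), of a b]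
      ab \<open>V \<subseteq> W\<close> insert.IH reach[OF \<open>T \<subseteq> S\<close> ab(1,2)] unfolding eq
    by (auto simp: subset_iff)
qed simp

lemma rtrancl_sub: "(a, b) \<in> A\<^sup>* \<Longrightarrow> A \<subseteq> B\<^sup>* \<Longrightarrow> (a, b) \<in> B\<^sup>*"
  by (metis rtrancl_mono rtrancl_idemp subsetD)

text \<open>
  Seen from one side of a gluing along \<open>v\<close> and \<open>u\<close>, the only effect of the other side is whether
  it joins \<open>v\<close> to \<open>u\<close>; it may be replaced by one virtual edge or by nothing. The nontrivial
  direction retracts each walk onto \<open>V2\<close>, moving the vertices of \<open>V1\<close> to \<open>v\<close> or \<open>u\<close> according
  to whether they are joined to \<open>v\<close> inside \<open>V1\<close>.
\<close>

lemma reach_glue: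
  assumes R1: "R1 \<subseteq> V1 \<times> V1" "sym R1" and R2: "R2 \<subseteq> V2 \<times> V2"
    and VV: "V1 \<inter> V2 = {v, u}" and ab: "a \<in> V2" "b \<in> V2"
  shows "(a, b) \<in> (R1 \<union> R2)\<^sup>* \<longleftrightarrow>
    (a, b) \<in> ((if (v, u) \<in> R1\<^sup>* then {(v, u), (u, v)} else {}) \<union> R2)\<^sup>*"
    (is "_ \<longleftrightarrow> _ \<in> (?U \<union> R2)\<^sup>*")
proof
  have s: "(p, q) \<in> R1\<^sup>* \<longleftrightarrow> (q, p) \<in> R1\<^sup>*" for p q
    using R1 by (meson sym_rtrancl symE)
  assume *: "(a, b) \<in> (R1 \<union> R2)\<^sup>*"
  define \<rho> where "\<rho> x = (if x \<in> V2 then x else if (x, v) \<in> R1\<^sup>* then v else u)" for x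
  have uv: "v \<in> V2" "u \<in> V2" using VV by auto
  have \<rho>1: "\<rho> x = (if (x, v) \<in> R1\<^sup>* then v else u)" if "x \<in> V1" "(v, u) \<notin> R1\<^sup>*" for x
  proof (cases "x \<in> V2")
    case True
    with that VV have "x = v \<or> x = u" by auto
    with that(2) True s show ?thesis by (auto simp: \<rho>_def)
  qed (simp add: \<rho>_def)
  have "(\<rho> x, \<rho> y) \<in> (?U \<union> R2)\<^sup>*" if "(x, y) \<in> R1 \<union> R2" for x y
  proof (cases "(x, y) \<in> R2")
    case True
    then show ?thesis using R2 by (auto simp: \<rho>_def)
  next
    case False
    then have xy: "(x, y) \<in> R1" "x \<in> V1" "y \<in> V1" using that R1 by auto
    show ?thesis
    proof (cases "(v, u) \<in> R1\<^sup>*")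
      case True
      have "\<rho> x \<in> {v, u}" "\<rho> y \<in> {v, u}" using xy VV by (auto simp: \<rho>_def)
      with True show ?thesis by auto
    next
      case False
      have "(x, v) \<in> R1\<^sup>* \<longleftrightarrow> (y, v) \<in> R1\<^sup>*"
        using xy(1) s by (meson r_into_rtrancl rtrancl_trans)
      then show ?thesis using \<rho>1[OF xy(2) False] \<rho>1[OF xy(3) False] by simp
    qed
  qed
  from rtrancl_map_into[of a b "R1 \<union> R2" \<rho>, OF * this] show "(a, b) \<in> (?U \<union> R2)\<^sup>*"
    using ab by (simp add: \<rho>_def)
next
  have s: "(p, q) \<in> R1\<^sup>* \<longleftrightarrow> (q, p) \<in> R1\<^sup>*" for p q
    using R1 by (meson sym_rtrancl symE)
  assume "(a, b) \<in> (?U \<union> R2)\<^sup>*"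
  moreover have "?U \<subseteq> R1\<^sup>*" using s by auto
  then have "?U \<union> R2 \<subseteq> (R1 \<union> R2)\<^sup>*"
    using rtrancl_mono[of R1 "R1 \<union> R2"] by auto
  ultimately show "(a, b) \<in> (R1 \<union> R2)\<^sup>*" by (rule rtrancl_sub)
qed

text \<open>
  The two identified vertices cost two components, except that when both sides join \<open>v\<close> to
  \<open>u\<close> the second identification happens inside one component.
\<close>

lemma ncomp_glue:
  assumes R1: "R1 \<subseteq> V1 \<times> V1" "sym R1" and fin: "finite V1"
    and G: "finite_multigraph G" "S \<subseteq> edges G"
    and VV: "V1 \<inter> vertices G = {v, u}" "v \<noteq> u"
  shows "ncomp (V1 \<union> vertices G) (R1 \<union> adjacency G S) + 2 =
    ncomp V1 R1 + ncomp (vertices G) (adjacency G S)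
      + of_bool ((v, u) \<in> R1\<^sup>* \<and> (v, u) \<in> (adjacency G S)\<^sup>*)"
proof -
  let ?V = "vertices G"
    and ?c1 = "(v, u) \<in> R1\<^sup>*" and ?c2 = "(v, u) \<in> (adjacency G S)\<^sup>*"
  define U where "U = (if ?c1 then {(v, u), (u, v)} else {})"
  have finV: "finite ?V" "finite S"
    using G by (auto simp: finite_multigraph_def intro: finite_subset)
  have uv: "v \<in> ?V" "u \<in> ?V" using VV by auto
  have *: "ncomp (V1 \<union> ?V) (R1 \<union> adjacency G S) + ncomp ?V U =
      ncomp ?V (U \<union> adjacency G S) + ncomp (V1 \<union> ?V) R1"
  proof (rule ncomp_increment_cong)
    show "\<exists>a\<in>?V. \<exists>b\<in>?V. ends G e = Upair a b" if "e \<in> S" for e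
      using that G by (metis edge_ends subsetD)
    show "(a, b) \<in> (R1 \<union> adjacency G T)\<^sup>* \<longleftrightarrow> (a, b) \<in> (U \<union> adjacency G T)\<^sup>*"
      if "T \<subseteq> S" "a \<in> ?V" "b \<in> ?V" for T a b
      using that G by (intro reach_glue[OF R1 adjacency_subset VV(1), folded U_def]) auto
  qed (use fin finV R1 in \<open>auto simp: sym_def U_def\<close>)
  have "ncomp (V1 \<union> (?V - {v, u})) R1 = ncomp V1 R1 + card (?V - {v, u})"
    using fin finV R1 VV by (intro ncomp_isolated_Un) auto
  moreover have "V1 \<union> (?V - {v, u}) = V1 \<union> ?V" using VV by auto
  moreover have "card ?V = card (?V - {v, u}) + 2"
    using card_Diff_subset[of "{v, u}" ?V] card_mono[of ?V "{v, u}"] uv VV(2) finV by simp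
  moreover have "ncomp ?V U + of_bool ((v, u) \<in> R1\<^sup>*) = card ?V"
    using ncomp_add_edge[of ?V "{}" v u] uv VV(2) finV by (auto simp: ncomp_empty sym_def U_def)
  moreover have "ncomp ?V (adjacency G S) = ncomp ?V (U \<union> adjacency G S)
      + of_bool ((v, u) \<in> R1\<^sup>* \<and> (v, u) \<notin> (adjacency G S)\<^sup>*)"
    using ncomp_add_edge[OF finV(1) sym_adjacency, of v u G S] uv by (auto simp: Un_commute U_def)
  ultimately show ?thesis using * by (cases ?c1; cases ?c2) simp_all
qed

section \<open>Random-cluster sums of a graph with two terminals\<close>

text \<open>
  With \<open>q = (x - 1) (y - 1)\<close> and \<open>w = y - 1\<close>, the sum of \<open>q\<^sup>c w\<^sup>s\<close> over all edge sets with
  \<open>s\<close> edges and \<open>c\<close> components is the random-cluster (Fortuin-Kasteleyn) form of the Tutte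
  polynomial. Split according to whether the edge set joins two terminals, it becomes a pair of sums,
  and the pair of a graph glued from two parts is, up to powers of \<open>q\<close>, bilinear in the pairs of
  the parts.
\<close>

definition cluster_weight :: "('v, 'e) multigraph \<Rightarrow> 'a::comm_ring_1 \<Rightarrow> 'a \<Rightarrow> 'e set \<Rightarrow> 'a" where
  "cluster_weight G q w S = q ^ card (components G S) * w ^ card S"

definition cluster_sum :: "('v, 'e) multigraph \<Rightarrow> 'a::comm_ring_1 \<Rightarrow> 'a \<Rightarrow> 'a" where
  "cluster_sum G q w = (\<Sum>S\<in>Pow (edges G). cluster_weight G q w S)"

definition linked_sum :: "('v, 'e) multigraph \<Rightarrow> 'v \<Rightarrow> 'v \<Rightarrow> 'a::comm_ring_1 \<Rightarrow> 'a \<Rightarrow> 'a" where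
  "linked_sum G a b q w =
     (\<Sum>S\<in>Pow (edges G). of_bool ((a, b) \<in> (adjacency G S)\<^sup>*) * cluster_weight G q w S)"

definition unlinked_sum :: "('v, 'e) multigraph \<Rightarrow> 'v \<Rightarrow> 'v \<Rightarrow> 'a::comm_ring_1 \<Rightarrow> 'a \<Rightarrow> 'a" where
  "unlinked_sum G a b q w =
     (\<Sum>S\<in>Pow (edges G). of_bool ((a, b) \<notin> (adjacency G S)\<^sup>*) * cluster_weight G q w S)"

lemma cluster_sum_split: "cluster_sum G q w = linked_sum G a b q w + unlinked_sum G a b q w"
  unfolding cluster_sum_def linked_sum_def unlinked_sum_def sum.distrib[symmetric]
  by (intro sum.cong) auto

lemma reach_iso:
  assumes G: "finite_multigraph G" and f: "inj_on f (vertices G)" and S: "S \<subseteq> edges G"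
    and ends: "\<And>e. e \<in> edges G \<Longrightarrow> ends H (h e) = map_uprod f (ends G e)"
    and ab: "a \<in> vertices G" "b \<in> vertices G"
  shows "(f a, f b) \<in> (adjacency H (h ` S))\<^sup>* \<longleftrightarrow> (a, b) \<in> (adjacency G S)\<^sup>*"
proof
  assume *: "(f a, f b) \<in> (adjacency H (h ` S))\<^sup>*"
  let ?g = "inv_into (vertices G) f"
  have "(?g p, ?g q) \<in> (adjacency G S)\<^sup>*" if pq: "(p, q) \<in> adjacency H (h ` S)" for p q
  proof -
    obtain e where e: "e \<in> S" "ends H (h e) = Upair p q" using pq unfolding adjacency_iff by blast
    obtain x y where xy: "ends G e = Upair x y" "x \<in> vertices G" "y \<in> vertices G"
      using edge_ends[OF G] S e(1) by blast
    have "p = f x \<and> q = f y \<or> p = f y \<and> q = f x"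
      using e ends[of e] S xy(1) by auto
    then have "?g p = x \<and> ?g q = y \<or> ?g p = y \<and> ?g q = x"
      using f xy by auto
    moreover have "(x, y) \<in> adjacency G S" "(y, x) \<in> adjacency G S"
      using adjacencyI[OF e(1) xy(1)] .
    ultimately show ?thesis by auto
  qed
  from rtrancl_map_into[of _ _ _ ?g, OF * this] show "(a, b) \<in> (adjacency G S)\<^sup>*"
    using f ab by simp
next
  assume *: "(a, b) \<in> (adjacency G S)\<^sup>*"
  have "(f x, f y) \<in> (adjacency H (h ` S))\<^sup>*" if xy: "(x, y) \<in> adjacency G S" for x y
  proof -
    obtain e where e: "e \<in> S" "ends G e = Upair x y" using xy unfolding adjacency_iff by blast
    then have "ends H (h e) = Upair (f x) (f y)" using ends[of e] S by auto
    then show ?thesis using e(1) unfolding adjacency_def by blast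
  qed
  from rtrancl_map_into[of _ _ _ f, OF * this] show "(f a, f b) \<in> (adjacency H (h ` S))\<^sup>*" .
qed

lemma
  assumes G: "finite_multigraph G"
    and f: "vertices H = f ` vertices G" "inj_on f (vertices G)"
    and h: "edges H = h ` edges G" "inj_on h (edges G)"
    and ends: "\<And>e. e \<in> edges G \<Longrightarrow> ends H (h e) = map_uprod f (ends G e)"
    and ab: "a \<in> vertices G" "b \<in> vertices G"
  shows linked_sum_iso: "linked_sum H (f a) (f b) q w = linked_sum G a b q w"
    and unlinked_sum_iso: "unlinked_sum H (f a) (f b) q w = unlinked_sum G a b q w"
proof -
  have Pow: "Pow (edges H) = (`) h ` Pow (edges G)" using h(1) by (simp add: image_Pow_surj)
  have inj: "inj_on ((`) h) (Pow (edges G))" using h(2) by (simp add: inj_on_image_Pow)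
  have reach: "(f a, f b) \<in> (adjacency H (h ` S))\<^sup>* \<longleftrightarrow> (a, b) \<in> (adjacency G S)\<^sup>*"
    if "S \<in> Pow (edges G)" "a \<in> vertices G" "b \<in> vertices G" for S a b
    using that by (intro reach_iso[OF G f(2) _ ends]) auto
  have wt: "cluster_weight H q w (h ` S) = cluster_weight G q w S" if "S \<in> Pow (edges G)" for S
  proof -
    have "ncomp (vertices H) (adjacency H (h ` S)) = ncomp (vertices G) (adjacency G S)"
      by (rule ncomp_map) (use f reach that in auto)
    moreover have "card (h ` S) = card S" using h(2) that by (auto intro: card_image inj_on_subset)
    ultimately show ?thesis by (simp add: cluster_weight_def card_components)
  qed
  show "linked_sum H (f a) (f b) q w = linked_sum G a b q w"
    unfolding linked_sum_def Pow sum.reindex[OF inj] o_def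
    by (rule sum.cong) (use reach wt ab in auto)
  show "unlinked_sum H (f a) (f b) q w = unlinked_sum G a b q w"
    unfolding unlinked_sum_def Pow sum.reindex[OF inj] o_def
    by (rule sum.cong) (use reach wt ab in auto)
qed

lemma sum_Pow_insert:
  assumes "finite A" "x \<notin> A"
  shows "(\<Sum>S\<in>Pow (insert x A). f S) = (\<Sum>S\<in>Pow A. f S + f (insert x S))"
proof -
  have "(\<Sum>S\<in>Pow (insert x A). f S) = (\<Sum>S\<in>Pow A. f S) + (\<Sum>S\<in>insert x ` Pow A. f S)"
    unfolding Pow_insert using assms by (intro sum.union_disjoint) auto
  also have "(\<Sum>S\<in>insert x ` Pow A. f S) = (\<Sum>S\<in>Pow A. f (insert x S))"
    using assms(2) by (intro sum.reindex_cong[of "insert x"]) (auto simp: inj_on_def)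
  finally show ?thesis by (simp add: sum.distrib)
qed

lemma sum_Pow_Un:
  assumes "A \<inter> B = {}"
  shows "(\<Sum>S\<in>Pow (A \<union> B). f S) = (\<Sum>S\<in>Pow A. \<Sum>S'\<in>Pow B. f (S \<union> S'))"
  unfolding sum.cartesian_product
  by (rule sum.reindex_bij_witness[of _ "\<lambda>(S, S'). S \<union> S'" "\<lambda>S. (S \<inter> A, S \<inter> B)"])
    (use assms in \<open>auto simp: Int_Un_distrib[symmetric] intro!: arg_cong[of _ _ f]\<close>)

text \<open>
  Extending by an edge from the terminal \<open>p\<close> to a new vertex \<open>z\<close>, which becomes the terminal:
  without the edge, \<open>z\<close> is one more component and is not joined to \<open>v\<close>; with the edge, \<open>z\<close>
  behaves as \<open>p\<close> does.
\<close>

lemma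
  assumes G: "finite_multigraph G" and v: "v \<in> vertices G" "p \<in> vertices G"
    and z: "z \<notin> vertices G" and e: "e \<notin> edges G"
    and H: "vertices H = insert z (vertices G)" "edges H = insert e (edges G)"
      "ends H e = Upair p z" "\<And>e. e \<in> edges G \<Longrightarrow> ends H e = ends G e"
  shows linked_sum_pendant: "linked_sum H v z q w = w * linked_sum G v p q w"
    and unlinked_sum_pendant:
      "unlinked_sum H v z q w = q * cluster_sum G q w + w * unlinked_sum G v p q w"
proof -
  have adj: "adjacency H S = adjacency G S" if "S \<in> Pow (edges G)" for S
    using that H(4) by (intro adjacency_cong) auto
  have adj_e: "adjacency H (insert e S) = adjacency G S \<union> {(p, z), (z, p)}"
    if "S \<in> Pow (edges G)" for S
    using adjacency_insert[OF H(3), of S] adj[OF that] by simp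
  have sub: "adjacency G S \<subseteq> vertices G \<times> vertices G" if "S \<in> Pow (edges G)" for S
    using adjacency_subset[OF G] that by auto
  have no: "(v, z) \<notin> (adjacency G S)\<^sup>*" "(p, z) \<notin> (adjacency G S)\<^sup>*" if "S \<in> Pow (edges G)" for S
  proof -
    have "v \<noteq> z" "p \<noteq> z" using v z by auto
    then show "(v, z) \<notin> (adjacency G S)\<^sup>*" "(p, z) \<notin> (adjacency G S)\<^sup>*"
      using not_reach_isolated(1)[OF sub[OF that] z] by simp_all
  qed
  have iso: "ncomp (vertices H) (adjacency G S) = Suc (ncomp (vertices G) (adjacency G S))"
    if "S \<in> Pow (edges G)" for S
    unfolding H(1) using sub that z finite_vertices[OF G] by (intro ncomp_isolated) auto
  have wt: "cluster_weight H q w S = q * cluster_weight G q w S" if "S \<in> Pow (edges G)" for S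
    using iso[OF that] adj[OF that] by (simp add: cluster_weight_def card_components mult_ac)
  have wt_e: "cluster_weight H q w (insert e S) = w * cluster_weight G q w S"
    if "S \<in> Pow (edges G)" for S
  proof -
    have "ncomp (vertices H) (adjacency H (insert e S)) = ncomp (vertices G) (adjacency G S)"
      using ncomp_add_edge[of "vertices H" "adjacency G S" p z] iso[OF that] no[OF that]
        finite_vertices[OF G] v(2) unfolding adj_e[OF that] by (simp add: H(1) sym_adjacency)
    moreover have "card (insert e S) = Suc (card S)"
      using that e finite_edges[OF G] by (intro card_insert_disjoint) (auto intro: finite_subset)
    ultimately show ?thesis by (simp add: cluster_weight_def card_components mult_ac)
  qed
  have reach_e: "(v, z) \<in> (adjacency H (insert e S))\<^sup>* \<longleftrightarrow> (v, p) \<in> (adjacency G S)\<^sup>*"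
    if "S \<in> Pow (edges G)" for S
    unfolding adj_e[OF that] rtrancl_add_edge using no[OF that] by auto
  note Pow = sum_Pow_insert[OF finite_edges[OF G] e]
  show "linked_sum H v z q w = w * linked_sum G v p q w"
    unfolding linked_sum_def H(2) Pow sum_distrib_left
    by (rule sum.cong) (simp_all add: wt wt_e reach_e adj no)
  show "unlinked_sum H v z q w = q * cluster_sum G q w + w * unlinked_sum G v p q w"
    unfolding unlinked_sum_def cluster_sum_def H(2) Pow sum_distrib_left sum.distrib[symmetric]
    by (rule sum.cong) (simp_all add: wt wt_e reach_e adj no)
qed

text \<open>
  Parallel composition at both terminals. The terminals are joined in the union exactly if one of
  the parts joins them; the powers of \<open>q\<close> are those of \<open>ncomp_glue\<close>, and multiplying by
  \<open>q\<^sup>2\<close> keeps the identities free of division.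
\<close>

lemma
  assumes G1: "finite_multigraph G1" and G2: "finite_multigraph G2"
    and V: "vertices G1 \<inter> vertices G2 = {v, u}" "v \<noteq> u" and E: "edges G1 \<inter> edges G2 = {}"
    and H: "vertices H = vertices G1 \<union> vertices G2" "edges H = edges G1 \<union> edges G2"
      "\<And>e. e \<in> edges G1 \<Longrightarrow> ends H e = ends G1 e" "\<And>e. e \<in> edges G2 \<Longrightarrow> ends H e = ends G2 e"
  shows linked_sum_parallel: "q\<^sup>2 * linked_sum H v u q w =
      q * (linked_sum G1 v u q w * linked_sum G2 v u q w)
      + linked_sum G1 v u q w * unlinked_sum G2 v u q w
      + unlinked_sum G1 v u q w * linked_sum G2 v u q w"
    and unlinked_sum_parallel: "q\<^sup>2 * unlinked_sum H v u q w =
      unlinked_sum G1 v u q w * unlinked_sum G2 v u q w"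
proof -
  have adj: "adjacency H (S \<union> S') = adjacency G1 S \<union> adjacency G2 S'"
    if "S \<in> Pow (edges G1)" "S' \<in> Pow (edges G2)" for S S'
  proof -
    have "adjacency H S = adjacency G1 S" "adjacency H S' = adjacency G2 S'"
      using that H(3,4) by (auto intro!: adjacency_cong)
    then show ?thesis by (simp add: adjacency_Un)
  qed
  have reach: "(v, u) \<in> (adjacency H (S \<union> S'))\<^sup>* \<longleftrightarrow>
      (v, u) \<in> (adjacency G1 S)\<^sup>* \<or> (v, u) \<in> (adjacency G2 S')\<^sup>*"
    if "S \<in> Pow (edges G1)" "S' \<in> Pow (edges G2)" for S S'
  proof -
    have "v \<in> vertices G2" "u \<in> vertices G2" using V(1) by auto
    with that have *: "(v, u) \<in> (adjacency G1 S \<union> adjacency G2 S')\<^sup>* \<longleftrightarrow>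
        (v, u) \<in> ((if (v, u) \<in> (adjacency G1 S)\<^sup>* then {(v, u), (u, v)} else {})
          \<union> adjacency G2 S')\<^sup>*"
      by (intro reach_glue[OF _ sym_adjacency _ V(1)] adjacency_subset G1 G2) auto
    show ?thesis unfolding adj[OF that] * by auto
  qed
  have wt: "q\<^sup>2 * cluster_weight H q w (S \<union> S') =
      (if (v, u) \<in> (adjacency G1 S)\<^sup>* \<and> (v, u) \<in> (adjacency G2 S')\<^sup>* then q else 1)
        * (cluster_weight G1 q w S * cluster_weight G2 q w S')"
    (is "_ = (if ?c then _ else _) * _")
    if "S \<in> Pow (edges G1)" "S' \<in> Pow (edges G2)" for S S'
  proof -
    have "ncomp (vertices H) (adjacency H (S \<union> S')) + 2 =
        ncomp (vertices G1) (adjacency G1 S) + ncomp (vertices G2) (adjacency G2 S') + of_bool ?c"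
      unfolding adj[OF that] H(1)
      using that by (intro ncomp_glue[OF _ sym_adjacency finite_vertices[OF G1] G2 _ V]
          adjacency_subset[OF G1]) auto
    then have "q\<^sup>2 * q ^ card (components H (S \<union> S')) = (if ?c then q else 1) *
        (q ^ card (components G1 S) * q ^ card (components G2 S'))"
      unfolding card_components power_add[symmetric] by (auto simp: add.commute split: if_splits)
    moreover have "card (S \<union> S') = card S + card S'"
      using that E finite_edges[OF G1] finite_edges[OF G2]
      by (intro card_Un_disjoint) (auto intro: finite_subset)
    ultimately show ?thesis
      unfolding cluster_weight_def by (simp add: power_add mult_ac)
  qed
  note Pow = sum_Pow_Un[OF E]
  define l1 n1 l2 n2 where
    "l1 S = of_bool ((v, u) \<in> (adjacency G1 S)\<^sup>*) * cluster_weight G1 q w S" and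
    "n1 S = of_bool ((v, u) \<notin> (adjacency G1 S)\<^sup>*) * cluster_weight G1 q w S" and
    "l2 S = of_bool ((v, u) \<in> (adjacency G2 S)\<^sup>*) * cluster_weight G2 q w S" and
    "n2 S = of_bool ((v, u) \<notin> (adjacency G2 S)\<^sup>*) * cluster_weight G2 q w S" for S
  note defs = l1_def n1_def l2_def n2_def
  have sums: "linked_sum G1 v u q w = sum l1 (Pow (edges G1))"
    "unlinked_sum G1 v u q w = sum n1 (Pow (edges G1))"
    "linked_sum G2 v u q w = sum l2 (Pow (edges G2))"
    "unlinked_sum G2 v u q w = sum n2 (Pow (edges G2))"
    by (simp_all add: defs linked_sum_def unlinked_sum_def)
  have left: "q\<^sup>2 * (of_bool P * x) = of_bool P * (q\<^sup>2 * x)" for P x by simp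
  have "q\<^sup>2 * (of_bool ((v, u) \<in> (adjacency H (S \<union> S'))\<^sup>*) * cluster_weight H q w (S \<union> S')) =
      q * (l1 S * l2 S') + l1 S * n2 S' + n1 S * l2 S'"
    if "S \<in> Pow (edges G1)" "S' \<in> Pow (edges G2)" for S S'
    unfolding left wt[OF that] reach[OF that] defs by auto
  then have "q\<^sup>2 * linked_sum H v u q w =
      (\<Sum>S\<in>Pow (edges G1). \<Sum>S'\<in>Pow (edges G2).
        q * (l1 S * l2 S') + l1 S * n2 S' + n1 S * l2 S')"
    unfolding linked_sum_def H(2) Pow sum_distrib_left by (intro sum.cong refl)
  then show "q\<^sup>2 * linked_sum H v u q w =
      q * (linked_sum G1 v u q w * linked_sum G2 v u q w)
      + linked_sum G1 v u q w * unlinked_sum G2 v u q w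
      + unlinked_sum G1 v u q w * linked_sum G2 v u q w"
    by (simp only: sums sum_product sum.distrib) (simp only: sum_distrib_left)
  have "q\<^sup>2 * (of_bool ((v, u) \<notin> (adjacency H (S \<union> S'))\<^sup>*) * cluster_weight H q w (S \<union> S')) =
      n1 S * n2 S'"
    if "S \<in> Pow (edges G1)" "S' \<in> Pow (edges G2)" for S S'
    unfolding left wt[OF that] reach[OF that] defs by auto
  then have "q\<^sup>2 * unlinked_sum H v u q w =
      (\<Sum>S\<in>Pow (edges G1). \<Sum>S'\<in>Pow (edges G2). n1 S * n2 S')"
    unfolding unlinked_sum_def H(2) Pow sum_distrib_left by (intro sum.cong refl)
  then show "q\<^sup>2 * unlinked_sum H v u q w = unlinked_sum G1 v u q w * unlinked_sum G2 v u q w"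
    by (simp only: sums sum_product)
qed

lemma finite_multigraph_add_edge:
  "finite_multigraph G \<Longrightarrow> a \<in> vertices G \<Longrightarrow> b \<in> vertices G \<Longrightarrow> finite_multigraph (add_edge G a b)"
  by (auto simp: finite_multigraph_def add_edge_def add_edges_def)

lemma cluster_sum_add_edge:
  assumes G: "finite_multigraph G" and ab: "a \<in> vertices G" "b \<in> vertices G"
  shows "q * cluster_sum (add_edge G a b) q w =
    q * (1 + w) * linked_sum G a b q w + (q + w) * unlinked_sum G a b q w"
proof -
  let ?H = "add_edge G a b"
  have V: "vertices ?H = vertices G" and E: "edges ?H = insert (Inr ()) (Inl ` edges G)"
    by (auto simp: add_edge_def add_edges_def)
  have adj: "adjacency ?H (Inl ` S) = adjacency G S" for S
    by (auto simp: adjacency_def add_edge_def add_edges_def)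
  have adj_e: "adjacency ?H (insert (Inr ()) (Inl ` S)) = adjacency G S \<union> {(a, b), (b, a)}" for S
    using adjacency_insert[of ?H "Inr ()" a b "Inl ` S"] adj
    by (simp add: add_edge_def add_edges_def)
  have card: "card (insert (Inr ()) (Inl ` S) :: ('b + unit) set) = Suc (card S)"
    "card (Inl ` S :: ('b + unit) set) = card S" if "finite S" for S :: "'b set"
  proof -
    show c: "card (Inl ` S :: ('b + unit) set) = card S" by (simp add: card_image)
    have "card (insert (Inr ()) (Inl ` S) :: ('b + unit) set) = Suc (card (Inl ` S :: ('b + unit) set))"
      using that by (intro card_insert_disjoint) auto
    with c show "card (insert (Inr ()) (Inl ` S) :: ('b + unit) set) = Suc (card S)" by simp
  qed
  have Pow: "Pow (Inl ` edges G) = (`) Inl ` Pow (edges G)" by (simp add: image_Pow_surj)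
  have inj: "inj_on ((`) Inl) (Pow (edges G))" by (simp add: inj_on_image_Pow)
  have wt: "q * (cluster_weight ?H q w (Inl ` S) + cluster_weight ?H q w (insert (Inr ()) (Inl ` S)))
      = q * (1 + w) * (of_bool ((a, b) \<in> (adjacency G S)\<^sup>*) * cluster_weight G q w S)
        + (q + w) * (of_bool ((a, b) \<notin> (adjacency G S)\<^sup>*) * cluster_weight G q w S)"
    if "S \<in> Pow (edges G)" for S
  proof -
    have "finite S" using that finite_edges[OF G] by (auto intro: finite_subset)
    then show ?thesis
      using ncomp_add_edge[OF finite_vertices[OF G] sym_adjacency ab, of G S]
      by (auto simp: cluster_weight_def card_components V adj adj_e card algebra_simps)
  qed
  show ?thesis
    unfolding linked_sum_def unlinked_sum_def cluster_sum_def E sum_distrib_left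
    by (subst sum_Pow_insert)
      (use G in \<open>auto simp: finite_edges Pow sum.reindex[OF inj] wt
          sum.distrib[symmetric] distrib_left[symmetric]\<close>)
qed

lemma finite_multigraph_identify: "finite_multigraph G \<Longrightarrow> finite_multigraph (identify G S)"
  by (fastforce simp: finite_multigraph_def identify_def Let_def uprod.set_map)

text \<open>
  Identifying the terminals has the same effect on components as a virtual edge between them, so an
  edge set loses a component precisely if it does not join them.
\<close>

lemma cluster_sum_identify:
  assumes G: "finite_multigraph G" and vu: "v \<in> vertices G" "u \<in> vertices G"
  shows "q * cluster_sum (identify G {v, u}) q w = q * linked_sum G v u q w + unlinked_sum G v u q w"
proof -
  let ?H = "identify G {v, u}"
  define f where "f x = (if x \<in> {v, u} then None else Some x)" for x
  define g where "g y = (case y of None \<Rightarrow> v | Some x \<Rightarrow> x)" for y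
  have V: "vertices ?H = f ` vertices G" and E: "edges ?H = edges G"
    and ends: "ends ?H e = map_uprod f (ends G e)" for e
    by (simp_all add: identify_def f_def[abs_def] Let_def)
  have reach: "(f a, f b) \<in> (adjacency ?H S)\<^sup>* \<longleftrightarrow> (a, b) \<in> (adjacency G S \<union> {(v, u), (u, v)})\<^sup>*"
    (is "_ \<longleftrightarrow> _ \<in> ?R\<^sup>*") for a b S
  proof
    have gf: "(x, g (f x)) \<in> ?R\<^sup>*" "(g (f x), x) \<in> ?R\<^sup>*" for x
      by (auto simp: g_def f_def)
    assume *: "(f a, f b) \<in> (adjacency ?H S)\<^sup>*"
    have "(g p, g r) \<in> ?R\<^sup>*" if pr: "(p, r) \<in> adjacency ?H S" for p r
    proof -
      obtain e where e: "e \<in> S" "map_uprod f (ends G e) = Upair p r"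
        using pr unfolding adjacency_iff ends by blast
      obtain x y where xy: "ends G e = Upair x y" by (cases "ends G e")
      have adj: "(x, y) \<in> ?R" "(y, x) \<in> ?R"
        using adjacencyI[OF e(1) xy] by auto
      from e xy have "p = f x \<and> r = f y \<or> p = f y \<and> r = f x" by auto
      then show ?thesis
        using gf[of x] gf[of y] adj by (meson r_into_rtrancl rtrancl_trans)
    qed
    from rtrancl_map_into[of _ _ _ g, OF * this] show "(a, b) \<in> ?R\<^sup>*"
      using gf(1)[of a] gf(2)[of b] by (meson rtrancl_trans)
  next
    assume *: "(a, b) \<in> ?R\<^sup>*"
    have "(f x, f y) \<in> (adjacency ?H S)\<^sup>*" if "(x, y) \<in> ?R" for x y
    proof (cases "(x, y) \<in> adjacency G S")
      case True
      then obtain e where "e \<in> S" "ends G e = Upair x y" unfolding adjacency_iff by blast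
      then have "(f x, f y) \<in> adjacency ?H S" by (force simp: adjacency_def ends)
      then show ?thesis by blast
    next
      case False
      then have "f x = f y" using that by (auto simp: f_def)
      then show ?thesis by simp
    qed
    from rtrancl_map_into[of _ _ _ f, OF * this] show "(f a, f b) \<in> (adjacency ?H S)\<^sup>*" .
  qed
  have "q * cluster_weight ?H q w S =
      q * (of_bool ((v, u) \<in> (adjacency G S)\<^sup>*) * cluster_weight G q w S)
      + of_bool ((v, u) \<notin> (adjacency G S)\<^sup>*) * cluster_weight G q w S" for S
  proof -
    have "ncomp (vertices ?H) (adjacency ?H S) =
        ncomp (vertices G) (adjacency G S \<union> {(v, u), (u, v)})"
      by (rule ncomp_map[where h = f]) (use V reach in auto)
    then show ?thesis
      using ncomp_add_edge[OF finite_vertices[OF G] sym_adjacency vu, of G S]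
      by (auto simp: cluster_weight_def card_components)
  qed
  then show ?thesis
    unfolding linked_sum_def unlinked_sum_def cluster_sum_def E sum_distrib_left
      sum.distrib[symmetric] by simp
qed

section \<open>The Tutte polynomial as a random-cluster sum\<close>

lemma ncomp_pos: "finite V \<Longrightarrow> V \<noteq> {} \<Longrightarrow> 0 < ncomp V R"
  by (auto simp: ncomp_def card_gt_0_iff)

lemma ncomp_le: "finite V \<Longrightarrow> ncomp V R \<le> card V"
  by (simp add: ncomp_def card_image_le)

lemma card_vertices_le:
  assumes G: "finite_multigraph G" and S: "S \<subseteq> edges G"
  shows "card (vertices G) \<le> card S + ncomp (vertices G) (adjacency G S)"
  using finite_subset[OF S finite_edges[OF G]] S
proof (induction S rule: finite_subset_induct')
  case empty
  then show ?case by (simp add: ncomp_empty)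
next
  case (insert e T)
  obtain a b where ab: "ends G e = Upair a b" "a \<in> vertices G" "b \<in> vertices G"
    using edge_ends[OF G] insert.hyps by blast
  have "card (insert e T) = Suc (card T)" using insert.hyps by simp
  then show ?case
    using ncomp_add_edge[OF finite_vertices[OF G] sym_adjacency ab(2,3), of G T] insert.IH
    unfolding adjacency_insert[OF ab(1)] by (cases "(a, b) \<in> (adjacency G T)\<^sup>*") simp_all
qed

lemma ncomp_connected:
  assumes "connected_multigraph G"
  shows "ncomp (vertices G) (adjacency G (edges G)) = 1"
proof -
  have "(\<lambda>a. {b \<in> vertices G. (a, b) \<in> (adjacency G (edges G))\<^sup>*}) ` vertices G = {vertices G}"
    using assms by (auto simp: connected_multigraph_def)
  then show ?thesis by (simp add: ncomp_def)
qed

text \<open>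
  The inequalities proved above say that neither the rank nor the exponents in the definition of
  the Tutte polynomial truncate. The power of \<open>y - 1\<close> on the left then turns the nullity
  \<open>|S| - |V| + c\<close> into \<open>|S| + c\<close>, and \<open>x - 1\<close> turns \<open>c - 1\<close> into \<open>c\<close>.
\<close>

lemma tutte_cluster_sum:
  assumes G: "finite_multigraph G" "connected_multigraph G"
  shows "(x - 1) * (y - 1) ^ card (vertices G) * tutte G x y =
    cluster_sum G ((x - 1) * (y - 1)) (y - 1)"
proof -
  let ?N = "card (vertices G)" and ?c = "\<lambda>S. ncomp (vertices G) (adjacency G S)"
  have "(x - 1) * (y - 1) ^ ?N * ((x - 1) ^ (edge_rank G (edges G) - edge_rank G S)
      * (y - 1) ^ (card S - edge_rank G S)) = cluster_weight G ((x - 1) * (y - 1)) (y - 1) S"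
    if "S \<in> Pow (edges G)" for S
  proof -
    have "0 < ?c S"
      using G finite_vertices[OF G(1)] by (intro ncomp_pos) (auto simp: connected_multigraph_def)
    moreover have "?c S \<le> ?N" by (intro ncomp_le finite_vertices[OF G(1)])
    moreover have "?N \<le> card S + ?c S" using that by (intro card_vertices_le[OF G(1)]) auto
    moreover have "?c (edges G) = 1" by (rule ncomp_connected[OF G(2)])
    ultimately have "Suc (edge_rank G (edges G) - edge_rank G S) = ?c S"
      "?N + (card S - edge_rank G S) = ?c S + card S"
      by (auto simp: edge_rank_def card_components)
    then have "(x - 1) ^ ?c S = (x - 1) * (x - 1) ^ (edge_rank G (edges G) - edge_rank G S)"
      "(y - 1) ^ ?c S * (y - 1) ^ card S = (y - 1) ^ ?N * (y - 1) ^ (card S - edge_rank G S)"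
      by (metis power_Suc, metis power_add)
    then have "(x - 1) * (y - 1) ^ ?N * ((x - 1) ^ (edge_rank G (edges G) - edge_rank G S)
        * (y - 1) ^ (card S - edge_rank G S)) =
        (x - 1) ^ ?c S * ((y - 1) ^ ?c S * (y - 1) ^ card S)"
      by (simp only: mult_ac)
    then show ?thesis
      by (simp add: cluster_weight_def card_components power_mult_distrib mult_ac)
  qed
  then show ?thesis by (simp add: tutte_def cluster_sum_def sum_distrib_left)
qed

section \<open>The fan, built one copy at a time\<close>

definition fan_vertex :: "'v \<Rightarrow> nat \<Rightarrow> 'v \<Rightarrow> (nat \<times> 'v) option" where
  "fan_vertex v i w = (if w = v then None else Some (i, w))"

definition rail_vertex :: "'v \<Rightarrow> nat \<Rightarrow> (nat \<times> 'v) option" where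
  "rail_vertex u i = (if i = 0 then None else Some (i, u))"

text \<open>
  Indexing the edge from \<open>v\<close> to the first copy as rail number 0, and \<open>v\<close> itself as rail vertex
  number 0, makes the step to the first copy an instance of the general step, so that the
  recursion can start from a single vertex. The edge type and the edge names are those of
  \<^const>\<open>fan_plus\<close>.
\<close>

definition rail :: "nat \<Rightarrow> (nat \<times> 'e + nat) + unit" where
  "rail i = (if i = 0 then Inr () else Inl (Inr i))"

text \<open>
  In contrast to the end map of \<^const>\<open>fan_plus\<close>, this one does not depend on the number of copies,
  so each fan is literally a subgraph of the next.
\<close>

definition rail_fan_ends ::
  "('v, 'e) multigraph \<Rightarrow> 'v \<Rightarrow> 'v \<Rightarrow> (nat \<times> 'e + nat) + unit \<Rightarrow> (nat \<times> 'v) option uprod" where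
  "rail_fan_ends G v u =
     case_sum
       (case_sum (\<lambda>(i, e). map_uprod (fan_vertex v i) (ends G e))
         (\<lambda>i. Upair (Some (i, u)) (Some (i + 1, u))))
       (\<lambda>_. Upair None (Some (1, u)))"

definition rail_fan ::
  "('v, 'e) multigraph \<Rightarrow> 'v \<Rightarrow> 'v \<Rightarrow> nat \<Rightarrow>
     ((nat \<times> 'v) option, (nat \<times> 'e + nat) + unit) multigraph" where
  "rail_fan G v u n =
     \<lparr>vertices = insert None (Some ` ({1..n} \<times> (vertices G - {v}))),
      edges = Inl ` Inl ` ({1..n} \<times> edges G) \<union> rail ` {..<n},
      ends = rail_fan_ends G v u\<rparr>"

lemma rail_fan_simps [simp]:
  "vertices (rail_fan G v u n) = insert None (Some ` ({1..n} \<times> (vertices G - {v})))"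
  "edges (rail_fan G v u n) = Inl ` Inl ` ({1..n} \<times> edges G) \<union> rail ` {..<n}"
  "ends (rail_fan G v u n) = rail_fan_ends G v u"
  by (simp_all add: rail_fan_def)

lemma rail_fan_ends_rail: "rail_fan_ends G v u (rail i) = Upair (rail_vertex u i) (rail_vertex u (Suc i))"
  by (auto simp: rail_fan_ends_def rail_def rail_vertex_def)

lemma rail_fan_ends_copy:
  "rail_fan_ends G v u (Inl (Inl (i, e))) = map_uprod (fan_vertex v i) (ends G e)"
  by (simp add: rail_fan_ends_def)

lemma rail_vertex_in:
  "u \<in> vertices G \<Longrightarrow> v \<noteq> u \<Longrightarrow> i \<le> n \<Longrightarrow> rail_vertex u i \<in> vertices (rail_fan G v u n)"
  by (auto simp: rail_vertex_def)

lemma finite_multigraph_rail_fan: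
  assumes "finite_multigraph G" "u \<in> vertices G" "v \<noteq> u"
  shows "finite_multigraph (rail_fan G v u n)"
proof -
  have "set_uprod (rail_fan_ends G v u e) \<subseteq> vertices (rail_fan G v u n)"
    if "e \<in> edges (rail_fan G v u n)" for e
  proof -
    from that consider i e' where "e = Inl (Inl (i, e'))" "i \<in> {1..n}" "e' \<in> edges G"
      | i where "e = rail i" "i < n" by auto
    then show ?thesis
    proof cases
      case 1
      then have "set_uprod (ends G e') \<subseteq> vertices G" using assms(1) by (simp add: finite_multigraph_def)
      with 1 show ?thesis
        by (auto simp: rail_fan_ends_copy uprod.set_map fan_vertex_def)
    next
      case 2
      with rail_vertex_in[OF assms(2,3), of i n] rail_vertex_in[OF assms(2,3), of "Suc i" n]
      show ?thesis by (auto simp: rail_fan_ends_rail)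
    qed
  qed
  with assms(1) show ?thesis by (simp add: finite_multigraph_def)
qed

lemma card_rail_fan:
  assumes "finite_multigraph G" "v \<in> vertices G"
  shows "card (vertices (rail_fan G v u n)) = Suc (n * (card (vertices G) - 1))"
  using assms by (simp add: finite_multigraph_def card_image card_cartesian_product)

lemma inj_fan_vertex: "inj (fan_vertex v i)"
  by (auto simp: inj_def fan_vertex_def split: if_splits)

lemma rail_fan_0:
  "linked_sum (rail_fan G v u 0) None (rail_vertex u 0) q w = q"
  "unlinked_sum (rail_fan G v u 0) None (rail_vertex u 0) q w = 0"
proof -
  have "card (components (rail_fan G v u 0) {}) = 1"
    by (simp add: card_components ncomp_empty)
  then show "linked_sum (rail_fan G v u 0) None (rail_vertex u 0) q w = q"
    "unlinked_sum (rail_fan G v u 0) None (rail_vertex u 0) q w = 0"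
    by (simp_all add: linked_sum_def unlinked_sum_def cluster_weight_def rail_vertex_def)
qed

text \<open>
  The next fan arises by adding a pendant rail from the last rail vertex and then composing with a
  further copy of \<open>G\<close> in parallel, between \<open>v\<close> (which is \<^const>\<open>None\<close>) and the new rail vertex. The first
  step produces the sums \<open>w * a n\<close> and \<open>q * (a n + b n) + w * b n\<close>.
\<close>

lemma
  fixes G :: "('v, 'e) multigraph" and q w :: "'a::comm_ring_1"
  assumes G: "finite_multigraph G" and vu: "v \<in> vertices G" "u \<in> vertices G" "v \<noteq> u"
  defines "a n \<equiv> linked_sum (rail_fan G v u n) None (rail_vertex u n) q w"
    and "b n \<equiv> unlinked_sum (rail_fan G v u n) None (rail_vertex u n) q w"
    and "c \<equiv> linked_sum G v u q w" and "d \<equiv> unlinked_sum G v u q w"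
  shows linked_sum_rail_fan_Suc: "q\<^sup>2 * a (Suc n) =
      q * (w * a n * c) + w * a n * d + (q * (a n + b n) + w * b n) * c"
    and unlinked_sum_rail_fan_Suc: "q\<^sup>2 * b (Suc n) = (q * (a n + b n) + w * b n) * d"
proof -
  let ?F = "rail_fan G v u" and ?z = "Some (Suc n, u)"
  let ?M = "\<lparr>vertices = insert ?z (vertices (?F n)), edges = insert (rail n) (edges (?F n)),
    ends = rail_fan_ends G v u\<rparr>"
  let ?K = "\<lparr>vertices = fan_vertex v (Suc n) ` vertices G,
    edges = (Inl \<circ> Inl \<circ> Pair (Suc n)) ` edges G :: ((nat \<times> 'e + nat) + unit) set,
    ends = rail_fan_ends G v u\<rparr>"
  note finF = finite_multigraph_rail_fan[OF G vu(2,3), of n]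
  have z: "?z \<notin> vertices (?F n)" "?z = rail_vertex u (Suc n)" by (auto simp: rail_vertex_def)
  have new: "rail n \<notin> edges (?F n)" by (auto simp: rail_def split: if_splits)
  have V: "None \<in> vertices (?F n)" "rail_vertex u n \<in> vertices (?F n)"
    using rail_vertex_in[OF vu(2,3), of n n] by auto
  have M: "linked_sum ?M None ?z q w = w * a n"
    "unlinked_sum ?M None ?z q w = q * (a n + b n) + w * b n"
    using linked_sum_pendant[OF finF V z(1) new, of ?M q w]
      unlinked_sum_pendant[OF finF V z(1) new, of ?M q w]
    by (simp_all add: a_def b_def cluster_sum_split[of _ _ _ None "rail_vertex u n"]
        rail_fan_ends_rail z(2))
  have finM: "finite_multigraph ?M"
    using finF rail_vertex_in[OF vu(2,3), of n n]
    by (auto simp: finite_multigraph_def rail_fan_ends_rail z(2))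
  have finK: "finite_multigraph ?K"
    using G by (auto simp: finite_multigraph_def rail_fan_ends_copy uprod.set_map)
  have inj: "inj_on (Inl \<circ> Inl \<circ> Pair (Suc n)) (edges G)" by (auto simp: inj_on_def)
  have fv: "fan_vertex v (Suc n) v = None" "fan_vertex v (Suc n) u = ?z"
    using vu(3) by (auto simp: fan_vertex_def)
  have K: "linked_sum ?K None ?z q w = c" "unlinked_sum ?K None ?z q w = d"
    using linked_sum_iso[OF G _ inj_on_subset[OF inj_fan_vertex subset_UNIV] _ inj _ vu(1,2),
        where H = ?K and q = q and w = w, of v "Suc n"]
      unlinked_sum_iso[OF G _ inj_on_subset[OF inj_fan_vertex subset_UNIV] _ inj _ vu(1,2),
        where H = ?K and q = q and w = w, of v "Suc n"]
    by (simp_all add: fv c_def d_def rail_fan_ends_copy)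
  have VV: "vertices ?M \<inter> vertices ?K = {None, ?z}" "None \<noteq> ?z"
    using vu by (auto simp: fan_vertex_def image_iff)
  have EE: "edges ?M \<inter> edges ?K = {}"
    by (auto simp: rail_def split: if_splits)
  have VF: "vertices (?F (Suc n)) = vertices ?M \<union> vertices ?K"
    using vu by (auto simp: fan_vertex_def image_iff atLeastAtMostSuc_conv)
  have EF: "edges (?F (Suc n)) = edges ?M \<union> edges ?K"
    by (auto simp: atLeastAtMostSuc_conv lessThan_Suc)
  note par = finM finK VV EE VF EF
  show "q\<^sup>2 * a (Suc n) = q * (w * a n * c) + w * a n * d + (q * (a n + b n) + w * b n) * c"
    using linked_sum_parallel[OF par, of q w] unfolding M K unfolding a_def z(2) by simp
  show "q\<^sup>2 * b (Suc n) = (q * (a n + b n) + w * b n) * d"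
    using unlinked_sum_parallel[OF par, of q w] unfolding M K unfolding b_def z(2) by simp
qed

lemma connected_from_root:
  assumes "r \<in> vertices G" "\<And>a. a \<in> vertices G \<Longrightarrow> (r, a) \<in> (adjacency G (edges G))\<^sup>*"
  shows "connected_multigraph G"
  unfolding connected_multigraph_def
proof (intro conjI ballI)
  fix a b assume "a \<in> vertices G" "b \<in> vertices G"
  then have "(a, r) \<in> (adjacency G (edges G))\<^sup>*" "(r, b) \<in> (adjacency G (edges G))\<^sup>*"
    using assms(2) rtrancl_adjacency_sym[of a r G] by auto
  then show "(a, b) \<in> (adjacency G (edges G))\<^sup>*" by (rule rtrancl_trans)
qed (use assms(1) in auto)

lemma reach_image:
  assumes "(a, b) \<in> (adjacency G S)\<^sup>*"
    and "\<And>e. e \<in> S \<Longrightarrow> h e \<in> S' \<and> ends H (h e) = map_uprod f (ends G e)"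
  shows "(f a, f b) \<in> (adjacency H S')\<^sup>*"
proof (rule rtrancl_map_into[OF assms(1)])
  fix x y assume "(x, y) \<in> adjacency G S"
  then obtain e where e: "e \<in> S" "ends G e = Upair x y" unfolding adjacency_iff by blast
  then have "ends H (h e) = Upair (f x) (f y)" using assms(2)[of e] by auto
  then have "(f x, f y) \<in> adjacency H S'"
    using assms(2)[of e] e(1) by (intro adjacencyI(1)[of "h e"]) auto
  then show "(f x, f y) \<in> (adjacency H S')\<^sup>*" by blast
qed

lemma connected_rail_fan:
  assumes G: "connected_multigraph G" and v: "v \<in> vertices G"
  shows "connected_multigraph (rail_fan G v u n)" (is "connected_multigraph ?F")
proof (rule connected_from_root[of None])
  fix a assume "a \<in> vertices ?F"
  show "(None, a) \<in> (adjacency ?F (edges ?F))\<^sup>*"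
  proof (cases a)
    case (Some p)
    obtain i w where "p = (i, w)" by (cases p)
    with Some \<open>a \<in> vertices ?F\<close> have 2: "a = Some (i, w)" "i \<in> {1..n}" "w \<in> vertices G" "w \<noteq> v"
      by auto
    have "(v, w) \<in> (adjacency G (edges G))\<^sup>*"
      using G v 2(3) by (auto simp: connected_multigraph_def)
    from reach_image[OF this, where f = "fan_vertex v i" and h = "\<lambda>e. Inl (Inl (i, e))"
        and H = ?F and S' = "edges ?F"]
    have "(fan_vertex v i v, fan_vertex v i w) \<in> (adjacency ?F (edges ?F))\<^sup>*"
      using 2(2) by (simp add: rail_fan_ends_copy)
    then show ?thesis using 2 by (simp add: fan_vertex_def)
  qed simp
qed simp

lemma connected_identify:
  assumes G: "connected_multigraph G"
  shows "connected_multigraph (identify G S)" (is "connected_multigraph ?H")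
proof -
  define f where "f w = (if w \<in> S then None else Some w)" for w
  have V: "vertices ?H = f ` vertices G" "edges ?H = edges G" "ends ?H e = map_uprod f (ends G e)" for e
    by (simp_all add: identify_def f_def[abs_def] Let_def)
  show ?thesis
    unfolding connected_multigraph_def
  proof (intro conjI ballI)
    fix a b assume "a \<in> vertices ?H" "b \<in> vertices ?H"
    then obtain x y where xy: "a = f x" "b = f y" "x \<in> vertices G" "y \<in> vertices G"
      using V by auto
    then have "(x, y) \<in> (adjacency G (edges G))\<^sup>*"
      using G by (auto simp: connected_multigraph_def)
    from reach_image[OF this, where f = f and h = "\<lambda>e. e" and H = ?H and S' = "edges ?H"]
    show "(a, b) \<in> (adjacency ?H (edges ?H))\<^sup>*" using xy V by simp
  qed (use G V in \<open>auto simp: connected_multigraph_def\<close>)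
qed

lemma connected_add_edge:
  assumes G: "connected_multigraph G"
  shows "connected_multigraph (add_edge G a b)" (is "connected_multigraph ?H")
  unfolding connected_multigraph_def
proof (intro conjI ballI)
  fix x y assume "x \<in> vertices ?H" "y \<in> vertices ?H"
  then have "(x, y) \<in> (adjacency G (edges G))\<^sup>*"
    using G by (auto simp: connected_multigraph_def add_edge_def add_edges_def)
  from reach_image[OF this, where f = "\<lambda>x. x" and h = Inl and H = ?H and S' = "edges ?H"]
  show "(x, y) \<in> (adjacency ?H (edges ?H))\<^sup>*"
    by (auto simp: add_edge_def add_edges_def uprod.map_ident)
qed (use G in \<open>auto simp: connected_multigraph_def add_edge_def add_edges_def\<close>)

lemma fan_plus_eq_rail_fan:
  assumes "v \<in> vertices G" "1 \<le> n"
  shows "vertices (fan_plus G v u n) = vertices (rail_fan G v u n)"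
    and "edges (fan_plus G v u n) = edges (rail_fan G v u n)"
    and "\<And>e. finite_multigraph G \<Longrightarrow> e \<in> edges (rail_fan G v u n) \<Longrightarrow>
      ends (fan_plus G v u n) e = ends (rail_fan G v u n) e"
proof -
  define f where "f x = (if x \<in> {1..n} \<times> {v} then None else Some x)" for x :: "nat \<times> 'a"
  have "vertices (fan_plus G v u n) = f ` ({1..n} \<times> vertices G)"
    by (simp add: fan_plus_def fan_def add_edge_def add_edges_def identify_def copies_def
        f_def[abs_def] Let_def)
  moreover have "f (1, v) = None" "(1, v) \<in> {1..n} \<times> vertices G" using assms by (auto simp: f_def)
  ultimately show "vertices (fan_plus G v u n) = vertices (rail_fan G v u n)"
    using assms by (auto simp: f_def image_iff)
  have "rail ` {..<n} = insert (Inr ()) (Inl ` Inr ` {1..<n})"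
    using assms by (auto simp: rail_def image_iff)
  then show "edges (fan_plus G v u n) = edges (rail_fan G v u n)"
    by (auto simp: fan_plus_def fan_def add_edge_def add_edges_def identify_def copies_def Let_def)
  show "ends (fan_plus G v u n) e = ends (rail_fan G v u n) e"
    if "finite_multigraph G" "e \<in> edges (rail_fan G v u n)" for e
  proof -
    from that(2) consider i e' where "e = Inl (Inl (i, e'))" "i \<in> {1..n}" "e' \<in> edges G"
      | i where "e = rail i" "i < n" by auto
    then show ?thesis
    proof cases
      case 1
      have "f \<circ> Pair i = fan_vertex v i" using 1(2) by (auto simp: f_def fan_vertex_def)
      then show ?thesis
        using 1 by (simp add: fan_plus_def fan_def add_edge_def add_edges_def identify_def
          copies_def Let_def f_def[abs_def, symmetric] rail_fan_ends_copy uprod.map_comp del: One_nat_def)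
    next
      case 2
      then show ?thesis
        by (simp add: fan_plus_def fan_def add_edge_def add_edges_def
            rail_fan_ends_def rail_def)
    qed
  qed
qed

lemma fan_plus_sums:
  assumes G: "finite_multigraph G" and vu: "v \<in> vertices G" "u \<in> vertices G" "v \<noteq> u"
    and n: "1 \<le> n"
  shows "finite_multigraph (fan_plus G v u n)"
    and "linked_sum (fan_plus G v u n) None (Some (n, u)) q w =
      linked_sum (rail_fan G v u n) None (rail_vertex u n) q w"
    and "unlinked_sum (fan_plus G v u n) None (Some (n, u)) q w =
      unlinked_sum (rail_fan G v u n) None (rail_vertex u n) q w"
proof -
  note eq = fan_plus_eq_rail_fan[OF vu(1) n, where u = u]
  note fin = finite_multigraph_rail_fan[OF G vu(2,3), of n]
  show "finite_multigraph (fan_plus G v u n)"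
    using fin eq(3)[OF G] by (auto simp: finite_multigraph_def eq(1,2))
  have z: "rail_vertex u n = Some (n, u)" using n by (simp add: rail_vertex_def)
  have ends: "ends (fan_plus G v u n) e = map_uprod (\<lambda>x. x) (ends (rail_fan G v u n) e)"
    if "e \<in> edges (rail_fan G v u n)" for e
    using eq(3)[OF G that] by (simp add: uprod.map_ident)
  have V: "None \<in> vertices (rail_fan G v u n)" "Some (n, u) \<in> vertices (rail_fan G v u n)"
    using rail_vertex_in[OF vu(2,3), of n n] z by auto
  have im: "vertices (fan_plus G v u n) = (\<lambda>x. x) ` vertices (rail_fan G v u n)"
    "edges (fan_plus G v u n) = (\<lambda>x. x) ` edges (rail_fan G v u n)"
    unfolding eq(1,2) by simp_all
  show "linked_sum (fan_plus G v u n) None (Some (n, u)) q w =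
      linked_sum (rail_fan G v u n) None (rail_vertex u n) q w"
    unfolding z using linked_sum_iso[OF fin im(1) inj_on_id2 im(2) inj_on_id2 ends V] .
  show "unlinked_sum (fan_plus G v u n) None (Some (n, u)) q w =
      unlinked_sum (rail_fan G v u n) None (rail_vertex u n) q w"
    unfolding z using unlinked_sum_iso[OF fin im(1) inj_on_id2 im(2) inj_on_id2 ends V] .
qed

lemma connected_cong:
  assumes "connected_multigraph G" "vertices H = vertices G" "edges H = edges G"
    and "\<And>e. e \<in> edges G \<Longrightarrow> ends H e = ends G e"
  shows "connected_multigraph H"
  using assms adjacency_cong[of "edges G" H G] by (simp add: connected_multigraph_def)

lemma fan_plus_plus:
  assumes G: "finite_multigraph G" "connected_multigraph G"
    and vu: "v \<in> vertices G" "u \<in> vertices G" "v \<noteq> u" and n: "1 \<le> n"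
  shows "finite_multigraph (fan_plus_plus G v u n)"
    and "connected_multigraph (fan_plus_plus G v u n)"
    and "card (vertices (fan_plus_plus G v u n)) = Suc (n * (card (vertices G) - 1))"
    and "q * cluster_sum (fan_plus_plus G v u n) q w =
      q * (1 + w) * linked_sum (rail_fan G v u n) None (rail_vertex u n) q w
      + (q + w) * unlinked_sum (rail_fan G v u n) None (rail_vertex u n) q w"
proof -
  note eq = fan_plus_eq_rail_fan[OF vu(1) n, where u = u]
  note sums = fan_plus_sums[OF G(1) vu n]
  have V: "None \<in> vertices (fan_plus G v u n)" "Some (n, u) \<in> vertices (fan_plus G v u n)"
    unfolding eq(1) using vu n by auto
  show "finite_multigraph (fan_plus_plus G v u n)"
    unfolding fan_plus_plus_def by (rule finite_multigraph_add_edge[OF sums(1) V])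
  have "connected_multigraph (fan_plus G v u n)"
    by (rule connected_cong[OF connected_rail_fan[OF G(2) vu(1)] eq(1,2) eq(3)[OF G(1)]])
  then show "connected_multigraph (fan_plus_plus G v u n)"
    unfolding fan_plus_plus_def by (rule connected_add_edge)
  have "vertices (fan_plus_plus G v u n) = vertices (rail_fan G v u n)"
    unfolding eq(1)[symmetric] by (simp add: fan_plus_plus_def add_edge_def add_edges_def)
  then show "card (vertices (fan_plus_plus G v u n)) = Suc (n * (card (vertices G) - 1))"
    using card_rail_fan[OF G(1) vu(1), of u n] by metis
  show "q * cluster_sum (fan_plus_plus G v u n) q w =
      q * (1 + w) * linked_sum (rail_fan G v u n) None (rail_vertex u n) q w
      + (q + w) * unlinked_sum (rail_fan G v u n) None (rail_vertex u n) q w"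
    unfolding fan_plus_plus_def cluster_sum_add_edge[OF sums(1) V] sums(2,3) ..
qed

lemma card_identify:
  assumes "finite_multigraph G" "v \<in> vertices G" "u \<in> vertices G" "v \<noteq> u"
  shows "Suc (card (vertices (identify G {v, u}))) = card (vertices G)"
proof -
  have fin: "finite (vertices G)" by (rule finite_vertices[OF assms(1)])
  have "vertices (identify G {v, u}) = insert None (Some ` (vertices G - {v, u}))"
    using assms by (auto simp: identify_def Let_def)
  then have "card (vertices (identify G {v, u})) = Suc (card (vertices G - {v, u}))"
    using fin by (simp add: card_image)
  moreover have "card (vertices G - {v, u}) = card (vertices G) - card {v, u}"
    using fin assms by (intro card_Diff_subset) auto
  moreover have "card {v, u} \<le> card (vertices G)" using fin assms by (intro card_mono) auto
  ultimately show ?thesis using assms(4) by simp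
qed

section \<open>Second-order linear recurrences\<close>

text \<open>
  The Lucas sequence \<open>U\<close> with parameters \<open>p\<close> and \<open>- r\<close>; the sign makes both binomial sums
  of the theorem instances without alternating signs.
\<close>

fun lucas_seq :: "'a::comm_ring_1 \<Rightarrow> 'a \<Rightarrow> nat \<Rightarrow> 'a" where
  "lucas_seq p r 0 = 0"
| "lucas_seq p r (Suc 0) = 1"
| "lucas_seq p r (Suc (Suc n)) = p * lucas_seq p r (Suc n) + r * lucas_seq p r n"

lemma second_order_recurrence_lucas:
  assumes "\<And>n. f (Suc (Suc n)) = p * f (Suc n) + r * f n"
  shows "f (Suc n) = f (Suc 0) * lucas_seq p r (Suc n) + r * f 0 * lucas_seq p r n"
proof (induction n rule: less_induct)
  case (less n)
  consider "n = 0" | "n = Suc 0" | m where "n = Suc (Suc m)" by (metis not0_implies_Suc)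
  then show ?case
  proof cases
    case 3
    have 1: "f (Suc (Suc m)) = f (Suc 0) * lucas_seq p r (Suc (Suc m)) + r * f 0 * lucas_seq p r (Suc m)"
      and 2: "f (Suc m) = f (Suc 0) * lucas_seq p r (Suc m) + r * f 0 * lucas_seq p r m"
      using less[of "Suc m"] less[of m] 3 by simp_all
    have "f (Suc n) = p * f (Suc (Suc m)) + r * f (Suc m)" unfolding 3 by (rule assms)
    also have "\<dots> = f (Suc 0) * lucas_seq p r (Suc n) + r * f 0 * lucas_seq p r n"
      unfolding 1 2 3 by (simp add: algebra_simps)
    finally show ?thesis .
  qed (simp_all add: assms algebra_simps)
qed

lemma lucas_seq_binet:
  fixes s t :: "'a::field"
  assumes "s \<noteq> t"
  shows "lucas_seq (s + t) (- (s * t)) n = (s ^ n - t ^ n) / (s - t)"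
proof -
  have "lucas_seq (s + t) (- (s * t)) n * (s - t) = s ^ n - t ^ n"
  proof (induction n rule: less_induct)
    case (less n)
    consider "n = 0" | "n = Suc 0" | m where "n = Suc (Suc m)" by (metis not0_implies_Suc)
    then show ?case
    proof cases
      case 3
      have "lucas_seq (s + t) (- (s * t)) n * (s - t) =
          (s + t) * (lucas_seq (s + t) (- (s * t)) (Suc m) * (s - t))
          - s * t * (lucas_seq (s + t) (- (s * t)) m * (s - t))"
        unfolding 3 by (simp add: algebra_simps)
      also have "\<dots> = (s + t) * (s ^ Suc m - t ^ Suc m) - s * t * (s ^ m - t ^ m)"
        using less 3 by simp
      also have "\<dots> = s ^ n - t ^ n" unfolding 3 by (simp add: algebra_simps)
      finally show ?thesis .
    qed simp_all
  qed
  then show ?thesis using assms by (simp add: field_simps)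
qed

text \<open>
  Pascal's rule, applied along the diagonals of the triangle as for Fibonacci numbers. The summands
  with \<open>2 * j > n\<close>, in which the exponent of \<open>p\<close> truncates, have coefficient zero.
\<close>

lemma lucas_seq_Suc_binomial:
  "lucas_seq p r (Suc n) = (\<Sum>j\<le>n. of_nat ((n - j) choose j) * p ^ (n - 2 * j) * r ^ j)"
proof (induction n rule: less_induct)
  case (less n)
  let ?V = "\<lambda>n j. of_nat ((n - j) choose j) * p ^ (n - 2 * j) * r ^ j :: 'a"
  consider "n = 0" | "n = Suc 0" | m where "n = Suc (Suc m)" by (metis not0_implies_Suc)
  then show ?case
  proof cases
    case 3
    have step: "?V n (Suc j) = r * ?V m j + p * ?V (Suc m) (Suc j)" if "j \<le> m" for j
    proof -
      have "n - Suc j = Suc (m - j)" using that 3 by simp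
      then have ch: "(n - Suc j) choose Suc j = ((m - j) choose j) + ((m - j) choose Suc j)" by simp
      have pw: "p * (of_nat ((m - j) choose Suc j) * p ^ (Suc m - 2 * Suc j)) =
          of_nat ((m - j) choose Suc j) * p ^ (m - 2 * j)"
      proof (cases "2 * j < m")
        case True
        then have "m - 2 * j = Suc (Suc m - 2 * Suc j)" by simp
        then show ?thesis by (simp add: mult_ac)
      next
        case False
        then have 0: "(m - j) choose Suc j = 0" by (intro binomial_eq_0) simp
        show ?thesis unfolding 0 by simp
      qed
      have ex: "n - 2 * Suc j = m - 2 * j" "Suc m - Suc j = m - j" using 3 by simp_all
      have "p * ?V (Suc m) (Suc j) =
          p * (of_nat ((m - j) choose Suc j) * p ^ (Suc m - 2 * Suc j)) * r ^ Suc j"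
        unfolding ex(2) by (simp only: mult_ac)
      then show ?thesis unfolding pw ch ex(1) by (simp add: algebra_simps)
    qed
    have "(\<Sum>j\<le>n. ?V n j) = ?V n 0 + (\<Sum>j\<le>Suc m. ?V n (Suc j))"
      unfolding 3 by (rule sum.atMost_Suc_shift)
    also have "(\<Sum>j\<le>Suc m. ?V n (Suc j)) = (\<Sum>j\<le>m. ?V n (Suc j))"
      using 3 by simp
    also have "\<dots> = r * (\<Sum>j\<le>m. ?V m j) + p * (\<Sum>j\<le>m. ?V (Suc m) (Suc j))"
      unfolding sum_distrib_left sum.distrib[symmetric] by (intro sum.cong step) auto
    also have "?V n 0 + (r * (\<Sum>j\<le>m. ?V m j) + p * (\<Sum>j\<le>m. ?V (Suc m) (Suc j))) =
        p * (?V (Suc m) 0 + (\<Sum>j\<le>m. ?V (Suc m) (Suc j))) + r * (\<Sum>j\<le>m. ?V m j)"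
      using 3 by (simp add: algebra_simps)
    also have "?V (Suc m) 0 + (\<Sum>j\<le>m. ?V (Suc m) (Suc j)) = (\<Sum>j\<le>Suc m. ?V (Suc m) j)"
      by (rule sum.atMost_Suc_shift[symmetric])
    also have "p * (\<Sum>j\<le>Suc m. ?V (Suc m) j) + r * (\<Sum>j\<le>m. ?V m j) =
        p * lucas_seq p r (Suc (Suc m)) + r * lucas_seq p r (Suc m)"
      using less[of "Suc m"] less[of m] 3 by simp
    also have "\<dots> = lucas_seq p r (Suc n)" unfolding 3 by simp
    finally show ?thesis by simp
  qed simp_all
qed

lemma lucas_seq_binomial:
  "lucas_seq p r n =
    (\<Sum>j | int j \<le> (int n - 1) div 2. of_nat ((n - j - 1) choose j) * p ^ (n - 2 * j - 1) * r ^ j)"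
proof (cases n)
  case 0
  then have "{j. int j \<le> (int n - 1) div 2} = {}" by auto
  with 0 show ?thesis by simp
next
  case (Suc m)
  have "(\<Sum>j\<le>m. of_nat ((m - j) choose j) * p ^ (m - 2 * j) * r ^ j) =
      (\<Sum>j | int j \<le> (int n - 1) div 2. of_nat ((m - j) choose j) * p ^ (m - 2 * j) * r ^ j)"
  proof (intro sum.mono_neutral_right ballI)
    show "{j. int j \<le> (int n - 1) div 2} \<subseteq> {..m}" using Suc by auto
    fix j assume "j \<in> {..m} - {j. int j \<le> (int n - 1) div 2}"
    then have 0: "(m - j) choose j = 0" using Suc by (intro binomial_eq_0) auto
    show "of_nat ((m - j) choose j) * p ^ (m - 2 * j) * r ^ j = 0" unfolding 0 by simp
  qed simp
  then show ?thesis unfolding Suc lucas_seq_Suc_binomial by simp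
qed

section \<open>The discriminant does not vanish\<close>

text \<open>
  The random-cluster sums are polynomials in \<open>q\<close> and \<open>w\<close> with natural coefficients, hence natural
  with respect to ring homomorphisms. This allows both lifting them to polynomials and evaluating
  those at a point.
\<close>

lemma
  assumes h: "h 0 = 0" "h 1 = 1" "\<And>a b. h (a + b) = h a + h b" "\<And>a b. h (a * b) = h a * h b"
  shows linked_sum_hom: "h (linked_sum G a b q w) = linked_sum G a b (h q) (h w)"
    and unlinked_sum_hom: "h (unlinked_sum G a b q w) = unlinked_sum G a b (h q) (h w)"
proof -
  have sum: "h (sum f A) = (\<Sum>x\<in>A. h (f x))" for f and A :: "'z set"
    by (induction A rule: infinite_finite_induct) (simp_all add: h)
  have pow: "h (x ^ n) = h x ^ n" for x n by (induction n) (simp_all add: h)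
  have b: "h (of_bool P) = of_bool P" for P by (simp add: h)
  show "h (linked_sum G a b q w) = linked_sum G a b (h q) (h w)"
    "h (unlinked_sum G a b q w) = unlinked_sum G a b (h q) (h w)"
    by (simp_all add: linked_sum_def unlinked_sum_def cluster_weight_def sum pow b h(4))
qed

text \<open>
  At \<open>q = w = 1\<close> the sums count edge sets; the set of all edges joins any two vertices of a
  connected graph, and the empty set joins no two distinct ones.
\<close>

lemma linked_sum_1_pos:
  assumes "finite_multigraph G" "connected_multigraph G" "v \<in> vertices G" "u \<in> vertices G"
  shows "linked_sum G v u 1 (1 :: 'a::linordered_idom) > 0"
  unfolding linked_sum_def cluster_weight_def
  by (rule sum_pos2[of _ "edges G"])
    (use assms in \<open>auto simp: finite_edges connected_multigraph_def\<close>)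

lemma unlinked_sum_1_pos:
  assumes "finite_multigraph G" "v \<noteq> u"
  shows "unlinked_sum G v u 1 (1 :: 'a::linordered_idom) > 0"
  unfolding unlinked_sum_def cluster_weight_def
  by (rule sum_pos2[of _ "{}"]) (use assms in \<open>auto simp: finite_edges\<close>)

definition of_poly2 :: "rat poly poly \<Rightarrow> Qxy_closure" where
  "of_poly2 p = to_ac (to_fract p)"

lemma of_poly2_simps [simp]:
  "of_poly2 0 = 0" "of_poly2 1 = 1" "of_poly2 (p + r) = of_poly2 p + of_poly2 r"
  "of_poly2 (p - r) = of_poly2 p - of_poly2 r" "of_poly2 (p * r) = of_poly2 p * of_poly2 r"
  "of_poly2 p = 0 \<longleftrightarrow> p = 0"
  "of_poly2 [:[:0, 1:]:] = \<x>" "of_poly2 [:0, 1:] = \<y>"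
  by (simp_all add: of_poly2_def \<x>_def \<y>_def)

lemma of_poly2_nonzero:
  assumes "poly (poly p [:b:]) a \<noteq> 0"
  shows "of_poly2 p \<noteq> 0"
  using assms by auto

lemma generic_nonzero:
  "\<x> - 1 \<noteq> 0" "\<y> - 1 \<noteq> 0" "\<x> * \<y> - \<x> - \<y> \<noteq> 0"
proof -
  let ?X = "[:[:0, 1:]:] :: rat poly poly" and ?Y = "[:0, 1:] :: rat poly poly"
  have "of_poly2 (?X - 1) \<noteq> 0" by (rule of_poly2_nonzero[of _ 0 0]) simp
  then show "\<x> - 1 \<noteq> 0" by (simp only: of_poly2_simps(1-5,7,8) not_False_eq_True)
  have "of_poly2 (?Y - 1) \<noteq> 0" by (rule of_poly2_nonzero[of _ 0 0]) simp
  then show "\<y> - 1 \<noteq> 0" by (simp only: of_poly2_simps(1-5,7,8) not_False_eq_True)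
  have "of_poly2 (?X * ?Y - ?X - ?Y) \<noteq> 0" by (rule of_poly2_nonzero[of _ 1 1]) simp
  then show "\<x> * \<y> - \<x> - \<y> \<noteq> 0" by (simp only: of_poly2_simps(1-5,7,8) not_False_eq_True)
qed

text \<open>
  The expression is, up to a nonzero factor, the discriminant \<open>(A - C)\<^sup>2 + 4 A B\<close>. It is the image
  of a polynomial with rational coefficients. At \<open>x = y = 2\<close>, where \<open>q = w = 1\<close>, the numbers \<open>c\<close>
  and \<open>d\<close> are positive, so this polynomial takes a positive value there.
\<close>

lemma discriminant_nonzero:
  assumes "finite_multigraph G" "connected_multigraph G"
    and "v \<in> vertices G" "u \<in> vertices G" "v \<noteq> u"
  defines "c \<equiv> linked_sum G v u ((\<x> - 1) * (\<y> - 1)) (\<y> - 1)"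
    and "d \<equiv> unlinked_sum G v u ((\<x> - 1) * (\<y> - 1)) (\<y> - 1)"
  shows "(\<x> * d - (\<y> * ((\<x> - 1) * c) + d)) ^ 2 + 4 * (\<x> * d) * ((\<x> - 1) * c) \<noteq> 0"
proof -
  let ?X = "[:[:0, 1:]:] :: rat poly poly" and ?Y = "[:0, 1:] :: rat poly poly"
  define ev :: "rat poly poly \<Rightarrow> rat" where "ev p = poly (poly p [:2:]) 2" for p
  define c0 where "c0 = linked_sum G v u ((?X - 1) * (?Y - 1)) (?Y - 1)"
  define d0 where "d0 = unlinked_sum G v u ((?X - 1) * (?Y - 1)) (?Y - 1)"
  define D where "D = (?X * d0 - (?Y * ((?X - 1) * c0) + d0)) * (?X * d0 - (?Y * ((?X - 1) * c0) + d0))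
    + (1 + 1 + 1 + 1) * (?X * d0) * ((?X - 1) * c0)"
  have XY: "of_poly2 ((?X - 1) * (?Y - 1)) = (\<x> - 1) * (\<y> - 1)" "of_poly2 (?Y - 1) = \<y> - 1"
    by (simp_all only: of_poly2_simps)
  have "of_poly2 c0 = c" "of_poly2 d0 = d"
    unfolding c0_def d0_def c_def d_def
    by (simp_all only: linked_sum_hom[of of_poly2] unlinked_sum_hom[of of_poly2] of_poly2_simps)
  then have D: "of_poly2 D = (\<x> * d - (\<y> * ((\<x> - 1) * c) + d)) ^ 2 + 4 * (\<x> * d) * ((\<x> - 1) * c)"
    unfolding D_def by (simp only: of_poly2_simps power2_eq_square) simp
  have ev_hom: "ev 0 = 0" "ev 1 = 1" "ev (p + r) = ev p + ev r" "ev (p - r) = ev p - ev r"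
    "ev (p * r) = ev p * ev r" "ev ?X = 2" "ev ?Y = 2" for p r
    by (simp_all add: ev_def)
  have "ev c0 = linked_sum G v u 1 1" "ev d0 = unlinked_sum G v u 1 1"
    unfolding c0_def d0_def
    by (simp_all add: linked_sum_hom[of ev] unlinked_sum_hom[of ev] ev_hom del: pCons_one one_poly_eq_simps)
  then have pos: "ev c0 > 0" "ev d0 > 0"
    using linked_sum_1_pos[OF assms(1-4)] unlinked_sum_1_pos[OF assms(1,5)] by simp_all
  have "ev D = (2 * ev d0 - (2 * ((2 - 1) * ev c0) + ev d0)) ^ 2 + 4 * (2 * ev d0) * ((2 - 1) * ev c0)"
    unfolding D_def by (simp only: ev_hom power2_eq_square) simp
  also have "\<dots> > 0" using pos by (intro add_nonneg_pos) simp_all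
  finally show ?thesis using of_poly2_nonzero[of D 2 2] unfolding D ev_def by simp
qed

section \<open>The Tutte polynomial of the fan\<close>

text \<open>
  After division by the factors that relate Tutte polynomials to random-cluster sums, the step from
  one fan to the next is a fixed \<open>2\<times>2\<close> matrix. It depends on \<open>G\<close> only through \<open>P\<close> and \<open>R\<close>, the
  normalised parts of \<open>T(G)\<close> that come from the edge sets which do and do not join \<open>v\<close> to \<open>u\<close>.
  Since unlinked edge sets have at least two components, the second normalisation contains an
  additional factor \<open>x - 1\<close>. The initial vector belongs to a single vertex; the row vector
  \<open>(y, x)\<close> accounts for the closing edge from the last copy to \<open>v\<close>.
\<close>

lemma fan_transfer_matrix:
  fixes G :: "('v, 'e) multigraph" and x y :: "'a::field"
  assumes G: "finite_multigraph G" "connected_multigraph G"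
    and vu: "v \<in> vertices G" "u \<in> vertices G" "v \<noteq> u"
    and xy: "x - 1 \<noteq> 0" "y - 1 \<noteq> 0"
  defines "P \<equiv> linked_sum G v u ((x - 1) * (y - 1)) (y - 1) / ((x - 1) * (y - 1) ^ card (vertices G))"
    and "R \<equiv> unlinked_sum G v u ((x - 1) * (y - 1)) (y - 1)
      / ((x - 1)\<^sup>2 * (y - 1) ^ card (vertices G))"
  shows "tutte G x y = P + (x - 1) * R"
    and "tutte (identify G {v, u}) x y = (y - 1) * P + R"
    and "\<exists>\<alpha> \<beta>. \<alpha> 0 = 1 \<and> \<beta> 0 = 0 \<and>
      (\<forall>n. \<alpha> (Suc n) = (y * P + R) * \<alpha> n + x * P * \<beta> n) \<and>
      (\<forall>n. \<beta> (Suc n) = R * \<alpha> n + x * R * \<beta> n) \<and>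
      (\<forall>n\<ge>1. tutte (fan_plus_plus G v u n) x y = y * \<alpha> n + x * \<beta> n)"
proof -
  define z w where "z = x - 1" and "w = y - 1"
  have x: "x = z + 1" and y: "y = w + 1" by (simp_all add: z_def w_def)
  have nz: "z \<noteq> 0" "w \<noteq> 0" using xy by (simp_all add: z_def w_def)
  obtain m where m: "card (vertices G) = Suc m"
    using vu(1) finite_vertices[OF G(1)] by (metis card_gt_0_iff empty_iff gr0_implies_Suc)
  define E where "E = w ^ m"
  have nzE: "E \<noteq> 0" using nz by (simp add: E_def)
  define q where "q = z * w"
  define c d where "c = linked_sum G v u q w" and "d = unlinked_sum G v u q w"
  have c: "c = z * (w * E) * P" and d: "d = z\<^sup>2 * (w * E) * R"
    using nz by (simp_all add: P_def R_def c_def d_def q_def m E_def flip: z_def w_def)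
  have "z * (w * E) * tutte G x y = c + d"
    using tutte_cluster_sum[OF G, of x y]
    by (simp add: m E_def c_def d_def q_def flip: z_def w_def cluster_sum_split)
  also have "\<dots> = z * (w * E) * (P + z * R)"
    by (simp add: c d algebra_simps power2_eq_square)
  finally show "tutte G x y = P + (x - 1) * R" using nz nzE by (simp add: z_def)
  have "q * (z * E * tutte (identify G {v, u}) x y) = q * c + d"
    using tutte_cluster_sum[OF finite_multigraph_identify[OF G(1)] connected_identify[OF G(2)],
        of x y "{v, u}"] card_identify[OF G(1) vu] cluster_sum_identify[OF G(1) vu(1,2), of q w]
    by (simp add: m E_def c_def d_def q_def flip: z_def w_def)
  also have "\<dots> = q * (z * E * (w * P + R))"
    by (simp add: c d q_def algebra_simps power2_eq_square)
  finally show "tutte (identify G {v, u}) x y = (y - 1) * P + R"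
    using nz nzE by (simp add: q_def flip: w_def)
  define a b where "a n = linked_sum (rail_fan G v u n) None (rail_vertex u n) q w"
    and "b n = unlinked_sum (rail_fan G v u n) None (rail_vertex u n) q w" for n
  define W where "W n = w ^ Suc (n * m)" for n
  have W: "W (Suc n) = E * W n" "W n \<noteq> 0" "W 0 = w" for n
    using nz by (simp_all add: W_def E_def power_add)
  define \<alpha> \<beta> where "\<alpha> n = a n / (z * W n)" and "\<beta> n = b n / (z\<^sup>2 * W n)" for n
  have ab: "a n = z * W n * \<alpha> n" "b n = z\<^sup>2 * W n * \<beta> n" for n
    using nz W by (simp_all add: \<alpha>_def \<beta>_def)
  have "\<alpha> 0 = 1" "\<beta> 0 = 0"
    using nz by (simp_all add: \<alpha>_def \<beta>_def a_def b_def rail_fan_0 W q_def)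
  moreover have "\<alpha> (Suc n) = (y * P + R) * \<alpha> n + x * P * \<beta> n" for n
  proof -
    let ?K = "q\<^sup>2 * (z * W (Suc n))"
    have "?K * \<alpha> (Suc n) = q\<^sup>2 * a (Suc n)" by (simp add: ab mult_ac)
    also have "\<dots> = q * (w * a n * c) + w * a n * d + (q * (a n + b n) + w * b n) * c"
      unfolding a_def b_def c_def d_def by (rule linked_sum_rail_fan_Suc[OF G(1) vu])
    also have "\<dots> = ?K * ((y * P + R) * \<alpha> n + x * P * \<beta> n)"
      unfolding ab c d W q_def x y by (simp add: algebra_simps power2_eq_square)
    finally show ?thesis using nz W(2)[of "Suc n"] by (simp add: q_def)
  qed
  moreover have "\<beta> (Suc n) = R * \<alpha> n + x * R * \<beta> n" for n
  proof -
    let ?K = "q\<^sup>2 * (z\<^sup>2 * W (Suc n))"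
    have "?K * \<beta> (Suc n) = q\<^sup>2 * b (Suc n)" by (simp add: ab mult_ac)
    also have "\<dots> = (q * (a n + b n) + w * b n) * d"
      unfolding a_def b_def d_def by (rule unlinked_sum_rail_fan_Suc[OF G(1) vu])
    also have "\<dots> = ?K * (R * \<alpha> n + x * R * \<beta> n)"
      unfolding ab d W q_def x by (simp add: algebra_simps power2_eq_square)
    finally show ?thesis using nz W(2)[of "Suc n"] by (simp add: q_def)
  qed
  moreover have "tutte (fan_plus_plus G v u n) x y = y * \<alpha> n + x * \<beta> n" if n: "1 \<le> n" for n
  proof -
    note F = fan_plus_plus[OF G vu n]
    let ?K = "q * (z * W n)"
    have "?K * tutte (fan_plus_plus G v u n) x y = q * cluster_sum (fan_plus_plus G v u n) q w"
      using tutte_cluster_sum[OF F(1,2), of x y] unfolding F(3) m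
      by (simp add: W_def q_def mult_ac flip: z_def w_def)
    also have "\<dots> = q * (1 + w) * a n + (q + w) * b n"
      unfolding a_def b_def by (rule F(4))
    also have "\<dots> = ?K * (y * \<alpha> n + x * \<beta> n)"
      unfolding ab q_def x y by (simp add: algebra_simps power2_eq_square)
    finally show ?thesis using nz W(2)[of n] by (simp add: q_def)
  qed
  ultimately show "\<exists>\<alpha> \<beta>. \<alpha> 0 = 1 \<and> \<beta> 0 = 0 \<and>
      (\<forall>n. \<alpha> (Suc n) = (y * P + R) * \<alpha> n + x * P * \<beta> n) \<and>
      (\<forall>n. \<beta> (Suc n) = R * \<alpha> n + x * R * \<beta> n) \<and>
      (\<forall>n\<ge>1. tutte (fan_plus_plus G v u n) x y = y * \<alpha> n + x * \<beta> n)" by blast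
qed

theorem theorem3p3:
  fixes G :: "('v, 'e) multigraph" and u v :: 'v and n :: nat
    and A B C s lam1 lam2 :: Qxy_closure
  assumes "finite_multigraph G" and "connected_multigraph G"
    and "v \<in> vertices G" and "u \<in> vertices G" and "v \<noteq> u"
    and "n \<ge> 1"
    and "A = \<x> / (\<x> * \<y> - \<x> - \<y>) * ((\<y> - 1) * T G - T (identify G {v, u}))"
    and "B = 1 / (\<x> * \<y> - \<x> - \<y>) * ((\<x> - 1) * T (identify G {v, u}) - T G)"
    and "C = 1 / (\<x> * \<y> - \<x> - \<y>) * ((\<x> * \<y> - \<y> - 1) * T (identify G {v, u}) - T G)"
    and "s ^ 2 = (A - C) ^ 2 + 4 * A * B"
    and "lam1 = (A + C + s) / 2"
    and "lam2 = (A + C - s) / 2"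
  shows "(T (fan_plus_plus G v u n) =
           T (graph_plus_plus G v u) * ((lam1 ^ n - lam2 ^ n) / (lam1 - lam2))
           - \<y> * A * T (identify G {v, u}) * ((lam1 ^ (n - 1) - lam2 ^ (n - 1)) / (lam1 - lam2))) \<and>
         (T (fan_plus_plus G v u n) =
           T (graph_plus_plus G v u) *
             (\<Sum>j | int j \<le> (int n - 1) div 2.
                of_nat ((n - j - 1) choose j) * (A + C) ^ (n - 2 * j - 1) * (A * B - A * C) ^ j)
           - \<y> * A * T (identify G {v, u}) *
             (\<Sum>j | int j \<le> (int n - 2) div 2.
                of_nat ((n - j - 2) choose j) * (A + C) ^ (n - 2 * j - 2) * A ^ j * (B - C) ^ j))"
proof -
  note G = assms(1-5)
  note nz = generic_nonzero
  define c d where "c = linked_sum G v u ((\<x> - 1) * (\<y> - 1)) (\<y> - 1)"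
    and "d = unlinked_sum G v u ((\<x> - 1) * (\<y> - 1)) (\<y> - 1)"
  define M where "M = (\<y> - 1) ^ card (vertices G)"
  define P R where "P = c / ((\<x> - 1) * M)" and "R = d / ((\<x> - 1)\<^sup>2 * M)"
  define k where "k = T (identify G {v, u})"
  note transfer = fan_transfer_matrix[OF G nz(1,2), folded c_def d_def M_def, folded P_def R_def]
  have t: "T G = P + (\<x> - 1) * R" and k: "k = (\<y> - 1) * P + R"
    using transfer(1,2) by (simp_all add: T_def k_def)
  \<comment> \<open>Solving the two equations above for \<open>P\<close> and \<open>R\<close> has, up to sign, determinant
    \<open>(x - 1) (y - 1) - 1\<close>, the denominator \<open>x y - x - y\<close>.\<close>
  have A: "A = \<x> * R"
  proof -
    have "(\<x> * \<y> - \<x> - \<y>) * A = \<x> * ((\<y> - 1) * T G - k)" using nz(3) by (simp add: assms(7) k_def)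
    also have "\<dots> = (\<x> * \<y> - \<x> - \<y>) * (\<x> * R)" unfolding t k by (simp add: algebra_simps)
    finally show ?thesis using nz(3) by simp
  qed
  have B: "B = P"
  proof -
    have "(\<x> * \<y> - \<x> - \<y>) * B = (\<x> - 1) * k - T G" using nz(3) by (simp add: assms(8) k_def)
    also have "\<dots> = (\<x> * \<y> - \<x> - \<y>) * P" unfolding t k by (simp add: algebra_simps)
    finally show ?thesis using nz(3) by simp
  qed
  have C: "C = \<y> * P + R"
  proof -
    have "(\<x> * \<y> - \<x> - \<y>) * C = (\<x> * \<y> - \<y> - 1) * k - T G" using nz(3) by (simp add: assms(9) k_def)
    also have "\<dots> = (\<x> * \<y> - \<x> - \<y>) * (\<y> * P + R)" unfolding t k by (simp add: algebra_simps)
    finally show ?thesis using nz(3) by simp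
  qed
  have BC: "B - C = - k" unfolding B C k by (simp add: algebra_simps)
  obtain \<alpha> \<beta> where \<alpha>: "\<alpha> 0 = 1" "\<And>n. \<alpha> (Suc n) = (\<y> * P + R) * \<alpha> n + \<x> * P * \<beta> n"
    and \<beta>: "\<beta> 0 = 0" "\<And>n. \<beta> (Suc n) = R * \<alpha> n + \<x> * R * \<beta> n"
    and fan: "\<And>n. n \<ge> 1 \<Longrightarrow> T (fan_plus_plus G v u n) = \<y> * \<alpha> n + \<x> * \<beta> n"
    using transfer(3) unfolding T_def by blast
  define \<tau> where "\<tau> n = \<y> * \<alpha> n + \<x> * \<beta> n" for n
  \<comment> \<open>Cayley-Hamilton for the transfer matrix, whose trace is \<open>A + C\<close> and whose determinant is
    \<open>A * k = - (A * (B - C))\<close>. At 0 the sequence has the value \<open>y\<close>, the origin of the factor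
    \<open>y\<close> in the second term.\<close>
  have "\<tau> (Suc (Suc n)) = (A + C) * \<tau> (Suc n) + A * (B - C) * \<tau> n" for n
    unfolding \<tau>_def \<alpha>(2) \<beta>(2) A B C by (simp add: algebra_simps)
  from second_order_recurrence_lucas[of \<tau>, OF this, of "n - 1"]
  have \<tau>: "\<tau> n = \<tau> 1 * lucas_seq (A + C) (A * (B - C)) n
      - \<y> * A * k * lucas_seq (A + C) (A * (B - C)) (n - 1)"
    using \<open>n \<ge> 1\<close> by (simp add: BC \<tau>_def[of 0] \<alpha>(1) \<beta>(1) mult_ac)
  have main: "T (fan_plus_plus G v u n) =
      T (graph_plus_plus G v u) * lucas_seq (A + C) (A * (B - C)) n
      - \<y> * A * T (identify G {v, u}) * lucas_seq (A + C) (A * (B - C)) (n - 1)"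
    using \<tau> fan[OF \<open>n \<ge> 1\<close>] fan[of 1] by (simp add: \<tau>_def graph_plus_plus_def k_def)
  have "s \<noteq> 0"
  proof
    assume "s = 0"
    then have D: "(A - C)\<^sup>2 + 4 * A * B = 0" using assms(10) by simp
    have "M \<noteq> 0" using nz by (simp add: M_def)
    then have c: "c = (\<x> - 1) * M * P" and d: "d = (\<x> - 1)\<^sup>2 * M * R"
      using nz by (simp_all add: P_def R_def)
    have "(\<x> * d - (\<y> * ((\<x> - 1) * c) + d)) ^ 2 + 4 * (\<x> * d) * ((\<x> - 1) * c) =
        ((\<x> - 1)\<^sup>2 * M)\<^sup>2 * ((A - C)\<^sup>2 + 4 * A * B)"
      unfolding A B C c d by (simp add: algebra_simps power2_eq_square)
    then show False
      using discriminant_nonzero[OF G] unfolding c_def[symmetric] d_def[symmetric] D by simp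
  qed
  have lam: "lam1 + lam2 = A + C" "lam1 - lam2 = s"
    unfolding assms(11,12) add_divide_distrib[symmetric] diff_divide_distrib[symmetric] by simp_all
  have "4 * (lam1 * lam2) = (lam1 + lam2)\<^sup>2 - (lam1 - lam2)\<^sup>2"
    by (simp add: algebra_simps power2_eq_square)
  also have "\<dots> = (A + C)\<^sup>2 - s\<^sup>2" unfolding lam ..
  also have "\<dots> = 4 * - (A * (B - C))"
    unfolding assms(10) by (simp add: algebra_simps power2_eq_square)
  finally have "- (lam1 * lam2) = A * (B - C)" by simp
  then have binet: "lucas_seq (A + C) (A * (B - C)) n = (lam1 ^ n - lam2 ^ n) / (lam1 - lam2)" for n
    using lucas_seq_binet[of lam1 lam2 n] lam \<open>s \<noteq> 0\<close> by auto
  have idx: "int (n - 1) - 1 = int n - 2" "n - 1 - j - 1 = n - j - 2"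
    "n - 1 - 2 * j - 1 = n - 2 * j - 2" for j
    using \<open>n \<ge> 1\<close> by simp_all
  have "A * (B - C) = A * B - A * C" by (simp add: algebra_simps)
  then have sum: "lucas_seq (A + C) (A * (B - C)) n =
      (\<Sum>j | int j \<le> (int n - 1) div 2.
        of_nat ((n - j - 1) choose j) * (A + C) ^ (n - 2 * j - 1) * (A * B - A * C) ^ j)"
    unfolding lucas_seq_binomial by simp
  have sum': "lucas_seq (A + C) (A * (B - C)) (n - 1) =
      (\<Sum>j | int j \<le> (int n - 2) div 2.
        of_nat ((n - j - 2) choose j) * (A + C) ^ (n - 2 * j - 2) * A ^ j * (B - C) ^ j)"
    unfolding lucas_seq_binomial idx by (simp add: power_mult_distrib mult.assoc)
  show ?thesis
    using main unfolding binet[symmetric] sum[symmetric] sum'[symmetric] by blast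
qed

end
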